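(* Let $\mu$ be a probability measure on the unit circle $\mathbb T$. Then $\mu$ is the $\circlearrowright$-limit of an infinitesimal array if and only if either the moment generating function $\psi_\mu$ is univalent on $\mathbb D$ or $\mu$ is the normalized Haar measure $\mathbf h$ on $\mathbb T$.
   Context: $\mathbb D=\{|z|<1\}$, $\mathbb T=\partial\mathbb D$. For a probability measure $\mu$ on $\mathbb T$: $\psi_\mu(z)=\int_{\mathbb T}\frac{xz}{1-xz}\mu(dx)$ and $\eta_\mu(z)=\frac{\psi_\mu(z)}{1+\psi_\mu(z)}$ for $z\in\mathbb D$; $\eta_\mu$ maps $\mathbb D$ to $\mathbb D$ and $\eta_\mu(0)=0$. Multiplicative monotone convolution $\mu\circlearrowright\nu$ is the probability measure on $\mathbb T$ with $\eta_{\mu\circlearrowright\nu}=\eta_\mu\circ\eta_\nu$. Univalent means holomorphic and injective. $\mathbf h=\frac{d\theta}{2\pi}$. A family $\{\mu_{n,j}: 1\le j\le k_n,\ n\ge1\}$ of probability measures on $\mathbb T$ is an infinitesimal (triangular) array if $k_n\uparrow\infty$ and for every $\delta\in(0,\pi)$, $\lim_{n\to\infty}\sup_{1\le j\le k_n}\mu_{n,j}(\mathbb T\setminus\{e^{i\theta}:\theta\in[-\delta,\delta]\})=0$. A probability measure $\mu$ on $\mathbb T$ is the $\circlearrowright$-limit of an infinitesimal array if there is an infinitesimal array $\{\mu_{n,j}\}$ such that $\mu_{n,1}\circlearrowright\cdots\circlearrowright\mu_{n,k_n}$ converges weakly to $\mu$ as $n\to\infty$. *)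

theory Defs
  imports "HOL-Probability.Probability"
begin

abbreviation unit_disc :: "complex set" (\<open>\<D>\<close>)
  where "\<D> \<equiv> ball 0 1"

abbreviation unit_circle :: "complex set" (\<open>\<T>\<close>)
  where "\<T> \<equiv> sphere 0 1"

definition borel_circle :: "complex measure"
  where "borel_circle = restrict_space borel \<T>"

text \<open>Fixing the sigma-algebra, and hence also the underlying space, makes equality of
  measures on the circle coincide with equality on Borel subsets of the circle.\<close>

definition circle_prob :: "complex measure \<Rightarrow> bool"
  where "circle_prob \<mu> \<longleftrightarrow> prob_space \<mu> \<and> sets \<mu> = sets borel_circle"

definition psi :: "complex measure \<Rightarrow> complex \<Rightarrow> complex"
  where "psi \<mu> z = (\<integral>x. x * z / (1 - x * z) \<partial>\<mu>)"

definition eta :: "complex measure \<Rightarrow> complex \<Rightarrow> complex"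
  where "eta \<mu> z = psi \<mu> z / (1 + psi \<mu> z)"

text \<open>The definite description is meaningful for probability measures on the circle:
  \<open>eta \<mu> \<circ> eta \<nu>\<close> is again a holomorphic self-map of the disc fixing \<open>0\<close>, hence it is
  \<open>eta \<rho>\<close> for some \<open>\<rho>\<close> by the Herglotz representation, and \<open>eta \<rho>\<close> determines the
  moments of \<open>\<rho>\<close>, hence \<open>\<rho>\<close>.\<close>

definition mono_conv :: "complex measure \<Rightarrow> complex measure \<Rightarrow> complex measure"
  where "mono_conv \<mu> \<nu> =
    (THE \<rho>. circle_prob \<rho> \<and> (\<forall>z\<in>\<D>. eta \<rho> z = eta \<mu> (eta \<nu> z)))"

text \<open>The convolution of \<open>m 1, \<dots>, m k\<close> in this order, for \<open>k \<ge> 1\<close>.\<close>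

definition mono_conv_upto :: "(nat \<Rightarrow> complex measure) \<Rightarrow> nat \<Rightarrow> complex measure"
  where "mono_conv_upto m k = foldl mono_conv (m 1) (map m [2..<Suc k])"

definition univalent_on :: "(complex \<Rightarrow> complex) \<Rightarrow> complex set \<Rightarrow> bool"
  where "univalent_on f S \<longleftrightarrow> f holomorphic_on S \<and> inj_on f S"

definition haar_circle :: "complex measure"
  where "haar_circle = distr (uniform_measure lborel {0..2 * pi}) borel_circle cis"

text \<open>Test functions need no boundedness assumption, since the circle is compact.\<close>

definition weak_conv_circle :: "(nat \<Rightarrow> complex measure) \<Rightarrow> complex measure \<Rightarrow> bool"
  where "weak_conv_circle M \<mu> \<longleftrightarrow>
    (\<forall>f :: complex \<Rightarrow> real. continuous_on \<T> f \<longrightarrow>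
      (\<lambda>n. \<integral>x. f x \<partial>(M n)) \<longlonglongrightarrow> (\<integral>x. f x \<partial>\<mu>))"

text \<open>Rows are indexed by \<open>n \<ge> 1\<close>, and row \<open>n\<close> consists of \<open>m n 1, \<dots>, m n (k n)\<close>;
  values of \<open>k\<close> and \<open>m\<close> outside these ranges are irrelevant.\<close>

definition infinitesimal_array ::
    "(nat \<Rightarrow> nat) \<Rightarrow> (nat \<Rightarrow> nat \<Rightarrow> complex measure) \<Rightarrow> bool"
  where "infinitesimal_array k m \<longleftrightarrow>
    (\<forall>n\<ge>1. 1 \<le> k n) \<and> mono_on {1..} k \<and> filterlim k at_top sequentially \<and>
    (\<forall>n\<ge>1. \<forall>j\<in>{1..k n}. circle_prob (m n j)) \<and>
    (\<forall>\<delta>\<in>{0<..<pi}.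
      (\<lambda>n. SUP j\<in>{1..k n}. measure (m n j) (\<T> - cis ` {-\<delta>..\<delta>})) \<longlonglongrightarrow> 0)"

definition limit_of_infinitesimal_array :: "complex measure \<Rightarrow> bool"
  where "limit_of_infinitesimal_array \<mu> \<longleftrightarrow>
    (\<exists>k m. infinitesimal_array k m \<and>
      weak_conv_circle (\<lambda>n. mono_conv_upto (m n) (k n)) \<mu>)"

end

theory Submission
  imports Defs "HOL-Complex_Analysis.Complex_Analysis" "HOL-Real_Asymp.Real_Asymp"
begin

text \<open>
  By Herglotz' theorem the transforms \<open>eta \<mu>\<close> are exactly the holomorphic self-maps of the disc
  fixing \<open>0\<close>, and \<open>eta \<mu>\<close> is injective iff \<open>psi \<mu>\<close> is.

  For a measure concentrated near \<open>1\<close>, \<open>psi\<close> is injective on a given disc of radius \<open>r < 1\<close>, because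
  \<open>(psi \<mu> z - psi \<mu> w) / (z - w)\<close> is the integral of \<open>x / ((1 - x * z) * (1 - x * w))\<close>, close to the
  value of the integrand at \<open>x = 1\<close>. By the Schwarz lemma, compositions of such \<open>eta\<close> remain injective on
  that disc, and by Hurwitz' theorem a limit is injective or constant; the constant \<open>0\<close> belongs to Haar
  measure.

  Conversely, \<open>f z = eta \<mu> (r * z)\<close> maps the disc onto a domain compactly contained in the disc. Let a
  path run radially from the unit circle to a point of maximal modulus on the boundary curve of the image
  and then once around that curve, and let \<open>\<Omega> t\<close> be the component of \<open>0\<close> in the disc slit along the path
  up to time \<open>t\<close>. The conformal radius of \<open>\<Omega> t\<close> is continuous in \<open>t\<close>, for every path, whether simple or
  not: normal families give continuity from the left and compact exhaustion gives it from the right.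
  Cutting at equal ratios of conformal radii writes \<open>f\<close> as a composition of \<open>n\<close> self-maps with derivative
  \<open>exp (L / n)\<close> at \<open>0\<close>. This derivative is the first moment, so the factors are uniformly
  concentrated near \<open>1\<close>.
\<close>

section \<open>The transforms of a measure on the circle\<close>

lemma circle_prob_space: "circle_prob \<mu> \<Longrightarrow> prob_space \<mu>"
  by (simp add: circle_prob_def)

lemma space_circle_prob: "circle_prob \<mu> \<Longrightarrow> space \<mu> = \<T>"
  by (metis borel_circle_def circle_prob_def sets_eq_imp_space_eq space_borel space_restrict_space2
      sets.top space_restrict_space inf_top_right)

lemma circle_prob_measurable:
  fixes f :: "complex \<Rightarrow> 'b::topological_space"
  assumes "circle_prob \<mu>" "continuous_on \<T> f"
  shows "f \<in> borel_measurable \<mu>"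
proof -
  have "f \<in> borel_measurable (restrict_space borel \<T>)"
    using assms(2) by (rule borel_measurable_continuous_on_restrict)
  moreover have "sets \<mu> = sets (restrict_space borel \<T>)"
    using assms(1) by (simp add: circle_prob_def borel_circle_def)
  ultimately show ?thesis
    using measurable_cong_sets by blast
qed

lemma circle_prob_integrable:
  fixes f :: "complex \<Rightarrow> 'b::{banach, second_countable_topology}"
  assumes "circle_prob \<mu>" "continuous_on \<T> f"
  shows "integrable \<mu> f"
proof -
  interpret prob_space \<mu> using assms(1) by (rule circle_prob_space)
  have "compact (f ` \<T>)"
    using assms(2) by (intro compact_continuous_image) auto
  then obtain B where "\<And>x. x \<in> \<T> \<Longrightarrow> norm (f x) \<le> B"
    using compact_imp_bounded[of "f ` \<T>"] unfolding bounded_iff by blast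
  then show ?thesis
    using assms space_circle_prob[OF assms(1)]
    by (intro integrable_const_bound[of _ B] circle_prob_measurable) (auto intro!: AE_I2)
qed

lemma circle_prob_integral_norm_le:
  fixes f :: "complex \<Rightarrow> 'b::{banach, second_countable_topology}"
  assumes "circle_prob \<mu>" "continuous_on \<T> f" "\<And>x. x \<in> \<T> \<Longrightarrow> norm (f x) \<le> B"
  shows "norm (\<integral>x. f x \<partial>\<mu>) \<le> B"
proof -
  interpret prob_space \<mu> using assms(1) by (rule circle_prob_space)
  have "norm (\<integral>x. f x \<partial>\<mu>) \<le> (\<integral>x. norm (f x) \<partial>\<mu>)"
    by (rule integral_norm_bound)
  also have "\<dots> \<le> (\<integral>x. B \<partial>\<mu>)"
    using assms space_circle_prob[OF assms(1)]
    by (intro integral_mono circle_prob_integrable) (auto intro!: continuous_intros)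
  finally show ?thesis by (simp add: prob_space)
qed

definition mom :: "complex measure \<Rightarrow> nat \<Rightarrow> complex"
  where "mom \<mu> n = (\<integral>x. x ^ n \<partial>\<mu>)"

lemma mom_0: "circle_prob \<mu> \<Longrightarrow> mom \<mu> 0 = 1"
  using prob_space.prob_space[OF circle_prob_space] by (simp add: mom_def)

lemma circle_times_disc_neq_1:
  assumes "x \<in> \<T>" "z \<in> \<D>" shows "x * z \<noteq> 1"
  using assms by (metis dist_0_norm less_irrefl mem_ball mem_sphere mult_1 norm_mult norm_one)

lemma continuous_on_psi_kernel:
  assumes "z \<in> \<D>" shows "continuous_on \<T> (\<lambda>x. x * z / (1 - x * z))"
  using circle_times_disc_neq_1[OF _ assms] by (auto intro!: continuous_intros)

text \<open>The kernel is a geometric series in \<open>x * z\<close>. On the circle its terms have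
  modulus \<open>norm z ^ Suc n\<close>, independent of \<open>x\<close>, so sum and integral may be
  exchanged.\<close>

lemma psi_sums:
  assumes "circle_prob \<mu>" "z \<in> \<D>"
  shows "(\<lambda>n. mom \<mu> (Suc n) * z ^ Suc n) sums psi \<mu> z"
proof -
  interpret prob_space \<mu> using assms(1) by (rule circle_prob_space)
  note sp = space_circle_prob[OF assms(1)]
  have z: "norm z < 1" using assms(2) by simp
  define f where "f n x = (x * z) ^ Suc n" for n and x :: complex
  have int: "integrable \<mu> (f n)" for n
    using assms unfolding f_def by (intro circle_prob_integrable continuous_intros)
  have nf: "norm (f n x) = norm z ^ Suc n" if "x \<in> \<T>" for n x
    using that by (simp add: f_def norm_mult norm_power)
  have "(\<lambda>n. integral\<^sup>L \<mu> (f n)) sums (\<integral>x. (\<Sum>n. f n x) \<partial>\<mu>)"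
  proof (rule sums_integral[OF int])
    show "AE x in \<mu>. summable (\<lambda>n. norm (f n x))"
      using nf z by (auto intro!: AE_I2 summable_mult summable_geometric simp: sp)
    have "(\<integral>x. norm (f n x) \<partial>\<mu>) = norm z ^ Suc n" for n
      using nf by (subst Bochner_Integration.integral_cong[OF refl, where g="\<lambda>_. norm z ^ Suc n"])
        (use prob_space in \<open>auto simp: sp\<close>)
    then show "summable (\<lambda>n. \<integral>x. norm (f n x) \<partial>\<mu>)"
      using z by (auto intro!: summable_mult summable_geometric)
  qed
  moreover have "integral\<^sup>L \<mu> (f n) = mom \<mu> (Suc n) * z ^ Suc n" for n
    unfolding f_def mom_def by (simp only: power_mult_distrib integral_mult_left_zero)
  moreover have "(\<integral>x. (\<Sum>n. f n x) \<partial>\<mu>) = psi \<mu> z"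
    unfolding psi_def
  proof (rule Bochner_Integration.integral_cong[OF refl])
    fix x assume "x \<in> space \<mu>"
    then have "norm (x * z) < 1" using z by (simp add: sp norm_mult)
    then have "(\<lambda>n. x * z * (x * z) ^ n) sums (x * z * (1 / (1 - x * z)))"
      by (intro sums_mult geometric_sums)
    then show "(\<Sum>n. f n x) = x * z / (1 - x * z)"
      by (simp add: f_def sums_iff)
  qed
  ultimately show ?thesis by simp
qed

text \<open>The value at index \<open>0\<close> is set to \<open>0\<close> because
  \<open>psi\<close> has no constant term, whereas the zeroth moment is \<open>1\<close>.\<close>

definition psi_coeff :: "complex measure \<Rightarrow> nat \<Rightarrow> complex"
  where "psi_coeff \<mu> n = (if n = 0 then 0 else mom \<mu> n)"

lemma psi_coeff_sums:
  assumes "circle_prob \<mu>" "z \<in> \<D>"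
  shows "(\<lambda>n. psi_coeff \<mu> n * z ^ n) sums psi \<mu> z"
proof -
  have "(\<lambda>n. psi_coeff \<mu> (Suc n) * z ^ Suc n) sums psi \<mu> z"
    using psi_sums[OF assms] by (simp add: psi_coeff_def)
  then show ?thesis
    by (subst (asm) sums_Suc_iff) (simp add: psi_coeff_def)
qed

lemma psi_holomorphic: "circle_prob \<mu> \<Longrightarrow> psi \<mu> holomorphic_on \<D>"
  using power_series_holomorphic[of 0 1 "psi_coeff \<mu>" "psi \<mu>"] psi_coeff_sums by simp

section \<open>The function \<open>eta\<close> as a self-map of the disc\<close>

lemma psi_0 [simp]: "psi \<mu> 0 = 0"
  by (simp add: psi_def)

lemma eta_0 [simp]: "eta \<mu> 0 = 0"
  by (simp add: eta_def)

text \<open>The kernel is \<open>1 / (1 - x * z) - 1\<close>, and inversion maps the disc with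
  centre \<open>1\<close> and radius \<open>1\<close> onto the half-plane of real part above
  \<open>1 / 2\<close>. The bound obtained is uniform in \<open>x\<close>, so it survives
  integration as a strict inequality.\<close>

lemma Re_psi_gt:
  assumes "circle_prob \<mu>" "z \<in> \<D>"
  shows "Re (psi \<mu> z) > - 1 / 2"
proof -
  interpret prob_space \<mu> using assms(1) by (rule circle_prob_space)
  note sp = space_circle_prob[OF assms(1)]
  define \<rho> where "\<rho> = norm z"
  have \<rho>: "0 \<le> \<rho>" "\<rho> < 1" using assms(2) by (auto simp: \<rho>_def)
  \<comment> \<open>This is the minimum of \<open>Re (u / (1 - u))\<close> over
    \<open>norm u = \<rho>\<close>, attained at \<open>u = - \<rho>\<close>.\<close>
  define c where "c = - \<rho> / (1 + \<rho>)"
  have c: "c > - 1/2" using \<rho> by (simp add: c_def field_simps)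
  have bd: "Re (x * z / (1 - x * z)) \<ge> c" if "x \<in> \<T>" for x
  proof -
    define w where "w = 1 - x * z"
    have nw: "norm (1 - w) = \<rho>" using that by (simp add: w_def \<rho>_def norm_mult)
    have w0: "w \<noteq> 0" using circle_times_disc_neq_1[OF that assms(2)] by (auto simp: w_def)
    have "norm w \<le> 1 + \<rho>"
      using norm_triangle_ineq4[of 1 "1 - w"] nw by simp
    then have w2: "(norm w)\<^sup>2 \<le> (1 + \<rho>)\<^sup>2" by (intro power_mono) auto
    have "\<rho>\<^sup>2 = (norm w)\<^sup>2 - 2 * Re w + 1"
      unfolding nw[symmetric] cmod_power2 by (simp add: power2_eq_square algebra_simps)
    then have e: "2 * Re w = (norm w)\<^sup>2 + (1 - \<rho>) * (1 + \<rho>)"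
      by (simp add: power2_eq_square algebra_simps)
    have Rw: "Re (1 / w) = Re w / (norm w)\<^sup>2"
      by (simp add: Re_divide cmod_power2)
    have "2 * Re (1 / w) = (2 * Re w) / (norm w)\<^sup>2" by (simp add: Rw)
    also have "\<dots> = 1 + (1 - \<rho>) * (1 + \<rho>) / (norm w)\<^sup>2"
      unfolding e add_divide_distrib using w0 by simp
    finally have "2 * Re (1 / w) = 1 + (1 - \<rho>) * (1 + \<rho>) / (norm w)\<^sup>2" .
    also have "\<dots> \<ge> 1 + (1 - \<rho>) * (1 + \<rho>) / (1 + \<rho>)\<^sup>2"
      using \<rho> w0 w2 by (intro add_left_mono divide_left_mono mult_nonneg_nonneg mult_pos_pos) auto
    also have "(1 - \<rho>) * (1 + \<rho>) / (1 + \<rho>)\<^sup>2 = (1 - \<rho>) / (1 + \<rho>)"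
      using \<rho> by (simp add: power2_eq_square)
    also have "1 + (1 - \<rho>) / (1 + \<rho>) = 2 * (c + 1)" using \<rho> by (simp add: c_def field_simps)
    finally have "Re (1 / w) \<ge> c + 1" by simp
    moreover have "x * z / (1 - x * z) = 1 / w - 1" using w0 by (simp add: w_def field_simps)
    ultimately show ?thesis by simp
  qed
  have int: "integrable \<mu> (\<lambda>x. x * z / (1 - x * z))"
    by (rule circle_prob_integrable[OF assms(1) continuous_on_psi_kernel[OF assms(2)]])
  have "c = (\<integral>x. c \<partial>\<mu>)" by (simp add: prob_space)
  also have "\<dots> \<le> (\<integral>x. Re (x * z / (1 - x * z)) \<partial>\<mu>)"
    using bd int by (intro integral_mono integrable_Re) (auto simp: sp)
  also have "\<dots> = Re (psi \<mu> z)"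
    unfolding psi_def using int by (rule integral_Re)
  finally show ?thesis using c by simp
qed

lemma one_plus_psi_neq_0:
  assumes "circle_prob \<mu>" "z \<in> \<D>" shows "1 + psi \<mu> z \<noteq> 0"
proof
  assume "1 + psi \<mu> z = 0"
  then have "Re (1 + psi \<mu> z) = 0" by simp
  then show False using Re_psi_gt[OF assms] by simp
qed

lemma eta_holomorphic: "circle_prob \<mu> \<Longrightarrow> eta \<mu> holomorphic_on \<D>"
  unfolding eta_def using one_plus_psi_neq_0 psi_holomorphic
  by (intro holomorphic_intros) auto

text \<open>Real part above \<open>- 1 / 2\<close> means that \<open>psi \<mu> z\<close> is nearer
  to \<open>0\<close> than to \<open>- 1\<close>, so the quotient defining \<open>eta\<close> has
  modulus below \<open>1\<close>.\<close>

lemma norm_eta_less_1: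
  assumes "circle_prob \<mu>" "z \<in> \<D>" shows "norm (eta \<mu> z) < 1"
proof -
  let ?p = "psi \<mu> z"
  have "(norm ?p)\<^sup>2 < (norm (1 + ?p))\<^sup>2"
    using Re_psi_gt[OF assms] unfolding cmod_power2 by (simp add: power2_eq_square algebra_simps)
  then have "norm ?p < norm (1 + ?p)" by (rule power_less_imp_less_base) simp
  then show ?thesis
    using one_plus_psi_neq_0[OF assms] by (simp add: eta_def norm_divide divide_less_eq_1)
qed

lemma norm_eta_le:
  assumes "circle_prob \<mu>" "z \<in> \<D>" shows "norm (eta \<mu> z) \<le> norm z"
  using Schwarz_Lemma(1)[OF eta_holomorphic[OF assms(1)]] norm_eta_less_1[OF assms(1)] assms(2)
  by simp

lemma psi_eq_eta:
  assumes "circle_prob \<mu>" "z \<in> \<D>" shows "psi \<mu> z = eta \<mu> z / (1 - eta \<mu> z)"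
  using one_plus_psi_neq_0[OF assms] by (simp add: eta_def field_simps)

text \<open>The two transforms are related by the Moebius map \<open>p / (1 + p)\<close> and its
  inverse \<open>w / (1 - w)\<close>.\<close>

lemma inj_on_eta_iff:
  assumes "circle_prob \<mu>" "A \<subseteq> \<D>" shows "inj_on (eta \<mu>) A \<longleftrightarrow> inj_on (psi \<mu>) A"
proof -
  have "eta \<mu> x = eta \<mu> y \<longleftrightarrow> psi \<mu> x = psi \<mu> y" if "x \<in> A" "y \<in> A" for x y
    using psi_eq_eta[OF assms(1), of x] psi_eq_eta[OF assms(1), of y] that assms(2)
    by (metis eta_def subsetD)
  then show ?thesis by (auto simp: inj_on_def)
qed

text \<open>Taylor coefficients at \<open>0\<close> are compared. The factor \<open>c\<close> covers
  three uses: \<open>c = 1\<close> for uniqueness, \<open>c = 0\<close> for a constant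
  \<open>psi\<close>, and general \<open>c\<close> for dilated transforms.\<close>

lemma moments_eq_if_psi_scaled:
  assumes "circle_prob \<rho>" "circle_prob \<nu>" "0 < r" "r \<le> 1" "norm c \<le> 1"
    and eq: "\<And>z. z \<in> ball 0 r \<Longrightarrow> psi \<rho> z = psi \<nu> (c * z)" and "n > 0"
  shows "mom \<rho> n = c ^ n * mom \<nu> n"
proof -
  have 1: "psi \<rho> has_fps_expansion Abs_fps (psi_coeff \<rho>)"
    using psi_coeff_sums[OF assms(1)]
    by (intro has_fps_expansionI) (auto intro!: eventually_nhds_in_open[THEN eventually_mono, of "\<D>"])
  have 2: "psi \<rho> has_fps_expansion Abs_fps (\<lambda>n. c ^ n * psi_coeff \<nu> n)"
  proof (rule has_fps_expansionI)
    have "(\<lambda>n. c ^ n * psi_coeff \<nu> n * z ^ n) sums psi \<rho> z" if "z \<in> ball 0 r" for z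
    proof -
      have "norm c * norm z \<le> 1 * norm z" using assms(5) by (intro mult_right_mono) auto
      then have "c * z \<in> \<D>" using assms(4) that by (auto simp: norm_mult)
      from psi_coeff_sums[OF assms(2) this] show ?thesis
        by (simp add: eq[OF that] power_mult_distrib mult_ac)
    qed
    then show "\<forall>\<^sub>F u in nhds 0. (\<lambda>n. Abs_fps (\<lambda>n. c ^ n * psi_coeff \<nu> n) $ n * u ^ n) sums psi \<rho> u"
      using assms(3) by (auto intro!: eventually_nhds_in_open[THEN eventually_mono, of "ball 0 r"])
  qed
  from fps_expansion_unique_complex[OF 1 2] have "psi_coeff \<rho> n = c ^ n * psi_coeff \<nu> n"
    by (metis fps_nth_Abs_fps)
  then show ?thesis using \<open>n > 0\<close> by (simp add: psi_coeff_def)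
qed

text \<open>As \<open>psi\<close> vanishes at \<open>0\<close>, division by \<open>1 + psi\<close>
  leaves the first-order term unchanged. This ties the derivative of a factor to the concentration
  of its measure.\<close>

lemma deriv_eta_0:
  assumes "circle_prob \<mu>" shows "deriv (eta \<mu>) 0 = mom \<mu> 1"
proof -
  have "psi \<mu> has_fps_expansion Abs_fps (psi_coeff \<mu>)"
    using psi_coeff_sums[OF assms]
    by (intro has_fps_expansionI) (auto intro!: eventually_nhds_in_open[THEN eventually_mono, of "\<D>"])
  from fps_nth_fps_expansion[OF this, of 1] have d: "deriv (psi \<mu>) 0 = mom \<mu> 1"
    by (simp add: psi_coeff_def)
  have "(psi \<mu> has_field_derivative mom \<mu> 1) (at 0)"
    using d psi_holomorphic[OF assms] by (metis centre_in_ball holomorphic_derivI open_ball zero_less_one)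
  then have "((\<lambda>z. psi \<mu> z / (1 + psi \<mu> z)) has_field_derivative mom \<mu> 1) (at 0)"
    by (auto intro!: derivative_eq_intros)
  then show ?thesis unfolding eta_def[abs_def] by (rule DERIV_imp_deriv)
qed

section \<open>Moments and weak convergence\<close>

text \<open>Separate exponents for \<open>x\<close> and its conjugate make products of monomials
  monomials again on the whole plane. On the circle each of them reduces to a multiple of a single
  power or of the conjugate of one.\<close>

inductive trig_poly :: "(complex \<Rightarrow> complex) \<Rightarrow> bool" where
  monomial: "trig_poly (\<lambda>x. a * x ^ i * cnj x ^ j)"
| add: "trig_poly f \<Longrightarrow> trig_poly g \<Longrightarrow> trig_poly (\<lambda>x. f x + g x)"

lemma trig_poly_mult:
  assumes "trig_poly f" "trig_poly g" shows "trig_poly (\<lambda>x. f x * g x)"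
  using assms(1)
proof induction
  case (monomial a i j)
  show ?case using assms(2)
  proof induction
    case (monomial b k l)
    have "(\<lambda>x. a * x ^ i * cnj x ^ j * (b * x ^ k * cnj x ^ l)) =
        (\<lambda>x. (a * b) * x ^ (i + k) * cnj x ^ (j + l))"
      by (simp add: power_add mult_ac)
    then show ?case by (simp only: trig_poly.monomial)
  next
    case (add f g)
    then show ?case using trig_poly.add[OF add.IH] by (simp add: algebra_simps)
  qed
next
  case (add f g)
  then show ?case using trig_poly.add[OF add.IH] by (simp add: algebra_simps)
qed

lemma trig_poly_real_polynomial:
  fixes g :: "complex \<Rightarrow> real"
  assumes "real_polynomial_function g" shows "trig_poly (\<lambda>x. of_real (g x))"
  using assms
proof induction
  case (linear f)
  interpret bounded_linear f by fact
  \<comment> \<open>A real-valued real-linear map of the plane has the form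
    \<open>a * x + cnj a * cnj x\<close>; its values at \<open>1\<close> and \<open>\<i>\<close>
    determine \<open>a\<close>.\<close>
  define a b where "a = (of_real (f 1) - \<i> * of_real (f \<i>)) / 2"
    and "b = (of_real (f 1) + \<i> * of_real (f \<i>)) / 2"
  have "of_real (f x) = a * x ^ 1 * cnj x ^ 0 + b * x ^ 0 * cnj x ^ 1" for x
  proof -
    have "f x = f (Re x *\<^sub>R 1 + Im x *\<^sub>R \<i>)"
      by (rule arg_cong[of _ _ f]) (simp add: complex_eq_iff)
    also have "\<dots> = Re x * f 1 + Im x * f \<i>" by (simp only: add scaleR real_scaleR_def)
    finally show ?thesis by (simp add: complex_eq_iff a_def b_def field_simps)
  qed
  then show ?case by (simp only:) (intro trig_poly.intros)
next
  case (const c)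
  show ?case using trig_poly.monomial[of "of_real c" 0 0] by simp
next
  case (add f g)
  then show ?case using trig_poly.add by simp
next
  case (mult f g)
  then show ?case using trig_poly_mult by simp
qed

lemma continuous_on_trig_poly: "trig_poly f \<Longrightarrow> continuous_on \<T> f"
  by (induction rule: trig_poly.induct) (auto intro!: continuous_intros)

lemma circle_mixed_power:
  assumes "x \<in> \<T>"
  shows "x ^ i * cnj x ^ j = (if j \<le> i then x ^ (i - j) else cnj (x ^ (j - i)))"
proof -
  have 1: "x * cnj x = 1" using assms by (simp add: complex_norm_square[symmetric])
  then have p: "x ^ k * cnj x ^ k = 1" for k by (metis power_mult_distrib power_one)
  show ?thesis
  proof (cases "j \<le> i")
    case True
    then have "x ^ i * cnj x ^ j = x ^ (i - j) * (x ^ j * cnj x ^ j)"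
      by (simp flip: power_add mult.assoc)
    then show ?thesis using True p by simp
  next
    case False
    then have "x ^ i * cnj x ^ j = (x ^ i * cnj x ^ i) * cnj x ^ (j - i)"
      by (simp add: mult.assoc flip: power_add)
    then show ?thesis using False p by simp
  qed
qed

lemma integral_monomial_circle:
  assumes "circle_prob \<mu>"
  shows "(\<integral>x. a * x ^ i * cnj x ^ j \<partial>\<mu>) = a * (if j \<le> i then mom \<mu> (i - j) else cnj (mom \<mu> (j - i)))"
proof -
  have "(\<integral>x. a * x ^ i * cnj x ^ j \<partial>\<mu>) =
      (\<integral>x. a * (if j \<le> i then x ^ (i - j) else cnj (x ^ (j - i))) \<partial>\<mu>)"
    by (rule Bochner_Integration.integral_cong)
      (use circle_mixed_power space_circle_prob[OF assms] in \<open>auto simp: mult.assoc\<close>)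
  then show ?thesis by (simp add: mom_def del: complex_cnj_power)
qed

text \<open>Negative Fourier coefficients are conjugates of positive ones and the zeroth is
  \<open>1\<close>, so the positive moments control all trigonometric polynomials. These are
  uniformly dense by the Stone-Weierstrass theorem.\<close>

lemma weak_conv_circle_if_moments:
  assumes M: "\<And>n. circle_prob (M n)" and \<mu>: "circle_prob \<mu>"
    and mom: "\<And>p. p > 0 \<Longrightarrow> (\<lambda>n. mom (M n) p) \<longlonglongrightarrow> mom \<mu> p"
  shows "weak_conv_circle M \<mu>"
  unfolding weak_conv_circle_def
proof (intro allI impI)
  fix f :: "complex \<Rightarrow> real" assume f: "continuous_on \<T> f"
  have mom': "(\<lambda>n. mom (M n) p) \<longlonglongrightarrow> mom \<mu> p" for p
    using mom[of p] mom_0[OF M] mom_0[OF \<mu>] by (cases "p = 0") auto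
  have tp: "(\<lambda>n. \<integral>x. g x \<partial>M n) \<longlonglongrightarrow> (\<integral>x. g x \<partial>\<mu>)" if "trig_poly g" for g
    using that
  proof induction
    case (monomial a i j)
    show ?case unfolding integral_monomial_circle[OF M] integral_monomial_circle[OF \<mu>]
      by (auto intro!: tendsto_intros mom')
  next
    case (add g h)
    have "integrable \<nu> g" "integrable \<nu> h" if "circle_prob \<nu>" for \<nu>
      using add that by (auto intro!: circle_prob_integrable continuous_on_trig_poly)
    then show ?case using M \<mu> add.IH by (simp add: tendsto_add)
  qed
  show "(\<lambda>n. \<integral>x. f x \<partial>M n) \<longlonglongrightarrow> (\<integral>x. f x \<partial>\<mu>)"
  proof (rule LIMSEQ_I)
    fix e :: real assume "e > 0"
    \<comment> \<open>Three errors of at most \<open>e / 4\<close> add up to less than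
      \<open>e\<close>: replacing \<open>f\<close> by \<open>g\<close> under each of the two
      measures, and the convergence for \<open>g\<close>.\<close>
    then obtain g where g: "real_polynomial_function g" "\<And>x. x \<in> \<T> \<Longrightarrow> \<bar>f x - g x\<bar> < e / 4"
      using Stone_Weierstrass_real_polynomial_function[OF _ f, of "e / 4"] by auto
    have gc: "continuous_on \<T> g"
      using g(1) continuous_on_polymonial_function real_polynomial_function_eq by blast
    have "(\<lambda>n. complex_of_real (\<integral>x. g x \<partial>M n)) \<longlonglongrightarrow> of_real (\<integral>x. g x \<partial>\<mu>)"
      using tp[OF trig_poly_real_polynomial[OF g(1)]] by simp
    then have "(\<lambda>n. \<integral>x. g x \<partial>M n) \<longlonglongrightarrow> (\<integral>x. g x \<partial>\<mu>)"
      using tendsto_Re by fastforce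
    then obtain N where N: "\<And>n. n \<ge> N \<Longrightarrow> norm ((\<integral>x. g x \<partial>M n) - (\<integral>x. g x \<partial>\<mu>)) < e / 4"
      using LIMSEQ_D[of _ _ "e / 4"] \<open>e > 0\<close> by fastforce
    have d: "norm ((\<integral>x. f x \<partial>\<nu>) - (\<integral>x. g x \<partial>\<nu>)) \<le> e / 4" if "circle_prob \<nu>" for \<nu>
    proof -
      have "(\<integral>x. f x \<partial>\<nu>) - (\<integral>x. g x \<partial>\<nu>) = (\<integral>x. f x - g x \<partial>\<nu>)"
        using that f gc by (simp add: circle_prob_integrable)
      also have "norm \<dots> \<le> e / 4"
        using that f gc g(2) by (intro circle_prob_integral_norm_le) (auto intro!: continuous_intros less_imp_le)
      finally show ?thesis .
    qed
    show "\<exists>N. \<forall>n\<ge>N. norm ((\<integral>x. f x \<partial>M n) - (\<integral>x. f x \<partial>\<mu>)) < e"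
    proof (intro exI[of _ N] allI impI)
      fix n assume "n \<ge> N"
      from N[OF this] d[OF M, of n] d[OF \<mu>] \<open>e > 0\<close>
      show "norm ((\<integral>x. f x \<partial>M n) - (\<integral>x. f x \<partial>\<mu>)) < e"
        unfolding real_norm_def abs_le_iff abs_less_iff by linarith
    qed
  qed
qed

text \<open>The indicator of a closed set is a pointwise limit of continuous functions built from
  the distance to that set, and closed sets form an intersection-stable generator of the Borel
  sets.\<close>

lemma circle_prob_eqI_continuous:
  assumes \<mu>: "circle_prob \<mu>" and \<nu>: "circle_prob \<nu>"
    and eq: "\<And>f :: complex \<Rightarrow> real. continuous_on \<T> f \<Longrightarrow> (\<integral>x. f x \<partial>\<mu>) = (\<integral>x. f x \<partial>\<nu>)"
  shows "\<mu> = \<nu>"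
proof -
  have sets: "sets \<rho> = sets (restrict_space borel \<T>)" if "circle_prob \<rho>" for \<rho>
    using that by (simp add: circle_prob_def borel_circle_def)
  have lim: "(\<lambda>n. \<integral>x. max 0 (1 - real n * infdist x C) \<partial>\<rho>) \<longlonglongrightarrow> measure \<rho> (C \<inter> \<T>)"
    if \<rho>: "circle_prob \<rho>" and C: "closed C" "C \<noteq> {}" for \<rho> C
  proof -
    interpret prob_space \<rho> using \<rho> by (rule circle_prob_space)
    have "(\<lambda>n. \<integral>x. max 0 (1 - real n * infdist x C) \<partial>\<rho>) \<longlonglongrightarrow> (\<integral>x. indicator (C \<inter> \<T>) x \<partial>\<rho>)"
    proof (rule integral_dominated_convergence[where w = "\<lambda>_. 1"])
      show "AE x in \<rho>. (\<lambda>n. max 0 (1 - real n * infdist x C)) \<longlonglongrightarrow> indicator (C \<inter> \<T>) x"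
      proof (rule AE_I2)
        fix x assume "x \<in> space \<rho>"
        then have x: "x \<in> \<T>" using space_circle_prob[OF \<rho>] by simp
        show "(\<lambda>n. max 0 (1 - real n * infdist x C)) \<longlonglongrightarrow> indicator (C \<inter> \<T>) x"
        proof (cases "x \<in> C")
          case True
          then show ?thesis using x by simp
        next
          case False
          then have "infdist x C > 0"
            using C in_closed_iff_infdist_zero[of C x] infdist_nonneg[of x C] by force
          moreover obtain N where "1 / infdist x C < real N"
            using reals_Archimedean2 by blast
          ultimately have "\<forall>n\<ge>N. max 0 (1 - real n * infdist x C) = 0"
            by (auto simp: field_simps max_def)
              (meson less_le_trans mult_right_mono not_le of_nat_le_iff order.strict_trans1 infdist_nonneg)
          then have "\<forall>\<^sub>F n in sequentially. max 0 (1 - real n * infdist x C) = 0"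
            by (auto simp: eventually_sequentially)
          then show ?thesis using False by (auto intro!: tendsto_eventually)
        qed
      qed
      show "(indicator (C \<inter> \<T>) :: complex \<Rightarrow> real) \<in> borel_measurable \<rho>"
        using C by (intro borel_measurable_indicator) (auto simp: sets[OF \<rho>] sets_restrict_space)
    qed (auto intro!: circle_prob_measurable[OF \<rho>] continuous_intros AE_I2 simp: infdist_nonneg)
    then show ?thesis
      by (simp add: space_circle_prob[OF \<rho>])
  qed
  have closed_eq: "measure \<mu> (C \<inter> \<T>) = measure \<nu> (C \<inter> \<T>)" if "closed C" for C
  proof (cases "C = {}")
    case False
    have "(\<integral>x. max 0 (1 - real n * infdist x C) \<partial>\<mu>) = (\<integral>x. max 0 (1 - real n * infdist x C) \<partial>\<nu>)" for n
      by (intro eq continuous_intros)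
    with lim[OF \<mu> that False] lim[OF \<nu> that False] show ?thesis
      using LIMSEQ_unique by auto
  qed auto
  \<comment> \<open>Both measures are transported to the whole plane, where the closed sets generate
    the sigma-algebra; intersecting with the circle recovers them afterwards.\<close>
  let ?d = "\<lambda>\<rho>. distr \<rho> borel (\<lambda>x. x)"
  have meas: "(\<lambda>x. x) \<in> \<rho> \<rightarrow>\<^sub>M borel" if "circle_prob \<rho>" for \<rho> :: "complex measure"
    using that by (intro circle_prob_measurable) auto
  have "?d \<mu> = ?d \<nu>"
  proof (rule measure_eqI_generator_eq[where E = "Collect closed" and A = "\<lambda>_. UNIV" and \<Omega> = UNIV])
    show "emeasure (?d \<mu>) X = emeasure (?d \<nu>) X" if "X \<in> Collect closed" for X
    proof -
      interpret m: prob_space \<mu> using \<mu> by (rule circle_prob_space)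
      interpret n: prob_space \<nu> using \<nu> by (rule circle_prob_space)
      show ?thesis
        using that closed_eq[of X] meas[OF \<mu>] meas[OF \<nu>]
        by (simp add: emeasure_distr space_circle_prob[OF \<mu>] space_circle_prob[OF \<nu>]
          m.emeasure_eq_measure n.emeasure_eq_measure)
    qed
    show "emeasure (?d \<mu>) UNIV \<noteq> \<infinity>"
      using prob_space.emeasure_space_1[OF prob_space.prob_space_distr[OF circle_prob_space[OF \<mu>] meas[OF \<mu>]]]
      by simp
  qed (auto simp: Int_stable_def borel_eq_closed sets_measure_of)
  then have e: "emeasure (?d \<mu>) A = emeasure (?d \<nu>) A" for A by simp
  show ?thesis
  proof (rule measure_eqI)
    show "sets \<mu> = sets \<nu>" using sets \<mu> \<nu> by simp
    fix A assume "A \<in> sets \<mu>"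
    then obtain B where B: "A = B \<inter> \<T>" "B \<in> sets borel"
      by (auto simp: sets[OF \<mu>] sets_restrict_space)
    then show "emeasure \<mu> A = emeasure \<nu> A"
      using e[of B] meas[OF \<mu>] meas[OF \<nu>]
      by (simp add: emeasure_distr space_circle_prob[OF \<mu>] space_circle_prob[OF \<nu>])
  qed
qed

text \<open>The convergence criterion, applied to a constant sequence, gives equal integrals of all
  continuous functions.\<close>

lemma circle_prob_eqI_moments:
  assumes "circle_prob \<mu>" "circle_prob \<nu>" "\<And>p. p > 0 \<Longrightarrow> mom \<mu> p = mom \<nu> p"
  shows "\<mu> = \<nu>"
proof (rule circle_prob_eqI_continuous[OF assms(1,2)])
  fix f :: "complex \<Rightarrow> real" assume "continuous_on \<T> f"
  moreover have "weak_conv_circle (\<lambda>_. \<mu>) \<nu>"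
    using assms by (intro weak_conv_circle_if_moments) auto
  ultimately show "(\<integral>x. f x \<partial>\<mu>) = (\<integral>x. f x \<partial>\<nu>)"
    using LIMSEQ_unique[OF tendsto_const] by (auto simp: weak_conv_circle_def)
qed

lemma circle_prob_eqI_eta:
  assumes "circle_prob \<mu>" "circle_prob \<nu>" "\<And>z. z \<in> \<D> \<Longrightarrow> eta \<mu> z = eta \<nu> z"
  shows "\<mu> = \<nu>"
proof (rule circle_prob_eqI_moments[OF assms(1,2)])
  fix p :: nat assume "p > 0"
  then show "mom \<mu> p = mom \<nu> p"
    using moments_eq_if_psi_scaled[OF assms(1,2), of 1 1 p] assms(3)
      psi_eq_eta[OF assms(1)] psi_eq_eta[OF assms(2)] by auto
qed

section \<open>The Herglotz representation\<close>

lemma circlepath_0_alt: "circlepath 0 r t = of_real r * cis (2 * pi * t)"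
  by (simp add: circlepath cis_conv_exp mult_ac)

text \<open>Cauchy's formula for Taylor coefficients, written out in the parameter: the derivative
  of the circle path cancels \<open>2 * pi * \<i>\<close> and one power in the denominator.\<close>

lemma has_integral_circlepath_coeff:
  assumes "f holomorphic_on \<D>" "0 < r" "r < 1"
  shows "((\<lambda>t. f (circlepath 0 r t) / circlepath 0 r t ^ n) has_integral (deriv ^^ n) f 0 / fact n) {0..1}"
proof -
  have "continuous_on (cball 0 r) f" "f holomorphic_on ball 0 r"
    using assms by (auto intro!: holomorphic_on_imp_continuous_on elim: holomorphic_on_subset)
  from Cauchy_has_contour_integral_higher_derivative_circlepath[OF this, of 0 n] assms(2)
  have "((\<lambda>u. f u / u ^ Suc n) has_contour_integral 2 * pi * \<i> / fact n * (deriv ^^ n) f 0) (circlepath 0 r)"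
    by simp
  then have "((\<lambda>t. f (circlepath 0 r t) / circlepath 0 r t ^ Suc n * (2 * pi * \<i> * circlepath 0 r t))
      has_integral 2 * pi * \<i> / fact n * (deriv ^^ n) f 0) {0..1}"
    unfolding has_contour_integral vector_derivative_circlepath by (simp add: circlepath mult_ac)
  from has_integral_mult_right[OF this, of "1 / (2 * pi * \<i>)"]
  have "((\<lambda>t. 1 / (2 * pi * \<i>) * (f (circlepath 0 r t) / circlepath 0 r t ^ Suc n * (2 * pi * \<i> * circlepath 0 r t)))
      has_integral (deriv ^^ n) f 0 / fact n) {0..1}"
    by simp
  moreover have "1 / (2 * pi * \<i>) * (f (circlepath 0 r t) / circlepath 0 r t ^ Suc n * (2 * pi * \<i> * circlepath 0 r t))
      = f (circlepath 0 r t) / circlepath 0 r t ^ n" for t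
    using assms(2) by (simp add: circlepath_0_alt)
  ultimately show ?thesis by simp
qed

text \<open>The real part is half the sum of \<open>f\<close> and its conjugate. For
  \<open>n > 0\<close> the first half yields the Taylor coefficient, and the second yields the
  conjugate of the value of \<open>f u * u ^ n\<close> at \<open>0\<close>, which is
  \<open>0\<close>. For \<open>n = 0\<close> each half contributes \<open>1 / 2\<close>.\<close>

lemma has_integral_Re_fourier:
  assumes "f holomorphic_on \<D>" "0 < r" "r < 1" "f 0 = 1"
  shows "((\<lambda>t. Re (f (circlepath 0 r t)) *\<^sub>R cis (- (2 * pi * t)) ^ n) has_integral
    (if n = 0 then 1 else of_real r ^ n * (deriv ^^ n) f 0 / (2 * fact n))) {0..1}"
proof -
  let ?c = "circlepath 0 r"
  have 1: "((\<lambda>t. f (?c t) / ?c t ^ n) has_integral (deriv ^^ n) f 0 / fact n) {0..1}"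
    by (rule has_integral_circlepath_coeff[OF assms(1-3)])
  have "(\<lambda>u. f u * u ^ n) holomorphic_on \<D>"
    using assms(1) by (intro holomorphic_intros)
  from has_integral_circlepath_coeff[OF this assms(2,3), of 0]
  have "((\<lambda>t. f (?c t) * ?c t ^ n) has_integral (0 ^ n)) {0..1}"
    using assms(4) by simp
  then have 2: "((\<lambda>t. cnj (f (?c t) * ?c t ^ n)) has_integral (0 ^ n)) {0..1}"
    using has_integral_cnj[of "\<lambda>t. f (?c t) * ?c t ^ n" "0 ^ n" "{0..1}"] by (simp add: o_def)
  have "((\<lambda>t. of_real r ^ n / 2 * (f (?c t) / ?c t ^ n) + 1 / (2 * of_real r ^ n) * cnj (f (?c t) * ?c t ^ n))
    has_integral of_real r ^ n / 2 * ((deriv ^^ n) f 0 / fact n) + 1 / (2 * of_real r ^ n) * 0 ^ n) {0..1}"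
    by (intro has_integral_add has_integral_mult_right 1 2)
  moreover have "of_real r ^ n / 2 * (f (?c t) / ?c t ^ n) + 1 / (2 * of_real r ^ n) * cnj (f (?c t) * ?c t ^ n)
      = Re (f (?c t)) *\<^sub>R cis (- (2 * pi * t)) ^ n" for t
  proof -
    have "of_real r ^ n / 2 * (f (?c t) / ?c t ^ n) = f (?c t) / 2 * (1 / cis (2 * pi * t)) ^ n"
      using assms(2) by (simp add: circlepath_0_alt power_mult_distrib power_divide)
    also have "1 / cis (2 * pi * t) = cis (- (2 * pi * t))" by (simp add: cis_inverse divide_inverse)
    finally have a: "of_real r ^ n / 2 * (f (?c t) / ?c t ^ n) = f (?c t) / 2 * cis (- (2 * pi * t)) ^ n" .
    have b: "1 / (2 * of_real r ^ n) * cnj (f (?c t) * ?c t ^ n) = cnj (f (?c t)) / 2 * cis (- (2 * pi * t)) ^ n"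
      using assms(2) by (simp add: circlepath_0_alt power_mult_distrib cis_cnj)
    have "f (?c t) / 2 + cnj (f (?c t)) / 2 = of_real (Re (f (?c t)))"
      by (simp add: complex_eq_iff)
    then show ?thesis unfolding a b by (metis distrib_right scaleR_conv_of_real)
  qed
  ultimately show ?thesis using assms(4) by (simp add: power_0_left split: if_splits)
qed

text \<open>The density is placed on the interval \<open>[0, 1]\<close> of the real line, not on the
  circle, so that the selection theorem for tight sequences of real distributions can be
  applied.\<close>

definition herglotz_density :: "(complex \<Rightarrow> complex) \<Rightarrow> real \<Rightarrow> real \<Rightarrow> real"
  where "herglotz_density f r t = indicator {0..1} t * Re (f (circlepath 0 r t))"

text \<open>The sign in \<open>cis (- \<theta>)\<close> makes the Fourier coefficients of positive index, rather than
  negative index, the moments that enter \<open>psi\<close>.\<close>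

lemma
  assumes f: "f holomorphic_on \<D>" "f 0 = 1" "\<And>z. z \<in> \<D> \<Longrightarrow> Re (f z) > 0" and r: "0 < r" "r < 1"
  defines "M \<equiv> density lborel (\<lambda>t. ennreal (herglotz_density f r t))"
  shows herglotz_real_distribution: "real_distribution M"
    and herglotz_measure_Icc: "measure M {-1<..1} = 1"
    and herglotz_integral: "(\<integral>t. cis (- (2 * pi * t)) ^ n \<partial>M) =
      (if n = 0 then 1 else of_real r ^ n * (deriv ^^ n) f 0 / (2 * fact n))"
proof -
  let ?c = "circlepath 0 r" and ?g = "\<lambda>n t. cis (- (2 * pi * t)) ^ n"
  have cD: "?c t \<in> \<D>" for t using r by (simp add: circlepath_0_alt norm_mult)
  have "continuous_on UNIV ?c" by (auto simp: circlepath_0_alt cis_conv_exp[abs_def] intro!: continuous_intros)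
  then have cont: "continuous_on UNIV (\<lambda>t. Re (f (?c t)))"
    using cD by (intro continuous_intros continuous_on_compose2[OF holomorphic_on_imp_continuous_on[OF f(1)]]) auto
  then have bm: "(\<lambda>t. Re (f (?c t))) \<in> borel_measurable borel"
    by (rule borel_measurable_continuous_onI)
  then have meas: "herglotz_density f r \<in> borel_measurable borel"
    unfolding herglotz_density_def[abs_def] by measurable
  have nn: "herglotz_density f r t \<ge> 0" for t
    using f(3)[OF cD, of t] by (simp add: herglotz_density_def indicator_def)
  have gcont: "continuous_on UNIV (?g n)" for n
    by (auto simp: cis_conv_exp intro!: continuous_intros)
  have int: "set_integrable lborel {0..1} (\<lambda>t. Re (f (?c t)) *\<^sub>R ?g n t)" for n
    by (intro borel_integrable_atLeastAtMost' continuous_on_scaleR)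
      (auto intro: continuous_on_subset[OF cont] continuous_on_subset[OF gcont])
  have I: "(LINT t:{0..1}|lborel. Re (f (?c t)) *\<^sub>R ?g n t) =
      (if n = 0 then 1 else of_real r ^ n * (deriv ^^ n) f 0 / (2 * fact n))" for n
    unfolding set_borel_integral_eq_integral(2)[OF int]
    by (rule integral_unique, rule has_integral_Re_fourier) (use assms in auto)
  have sc: "herglotz_density f r t *\<^sub>R ?g n t = indicator {0..1} t *\<^sub>R (Re (f (?c t)) *\<^sub>R ?g n t)" for n t
    by (simp add: herglotz_density_def)
  have J: "(\<integral>t. ?g n t \<partial>M) = (if n = 0 then 1 else of_real r ^ n * (deriv ^^ n) f 0 / (2 * fact n))" for n
  proof -
    have "?g n \<in> borel_measurable borel"
      by (rule borel_measurable_continuous_onI[OF gcont])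
    then have "(\<integral>t. ?g n t \<partial>M) = (\<integral>t. herglotz_density f r t *\<^sub>R ?g n t \<partial>lborel)"
      unfolding M_def using meas nn by (subst integral_density) auto
    then show ?thesis using I[of n] by (simp only: sc set_lebesgue_integral_def)
  qed
  show "(\<integral>t. ?g n t \<partial>M) = (if n = 0 then 1 else of_real r ^ n * (deriv ^^ n) f 0 / (2 * fact n))"
    by (rule J)
  have hint: "integrable lborel (herglotz_density f r)"
    using integrable_Re[OF int[of 0, unfolded set_integrable_def]]
    by (simp add: herglotz_density_def[abs_def])
  have "complex_of_real (\<integral>t. herglotz_density f r t \<partial>lborel) = 1"
    using I[of 0] by (simp add: set_lebesgue_integral_def herglotz_density_def scaleR_conv_of_real
      flip: integral_complex_of_real of_real_mult)
  then have 1: "(\<integral>t. herglotz_density f r t \<partial>lborel) = 1" by (simp only: of_real_eq_1_iff)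
  have em: "(\<integral>\<^sup>+ t. ennreal (herglotz_density f r t) \<partial>lborel) = 1"
    using nn_integral_eq_integral[OF hint] nn 1 by simp
  have "emeasure M (space M) = 1"
    unfolding M_def using meas em by (simp add: emeasure_density)
  then have "prob_space M" by (rule prob_spaceI)
  then show rd: "real_distribution M"
    by (simp add: real_distribution_def real_distribution_axioms_def M_def)
  interpret real_distribution M by (rule rd)
  have "emeasure M {-1<..1} = (\<integral>\<^sup>+ t. ennreal (herglotz_density f r t) * indicator {-1<..1} t \<partial>lborel)"
    unfolding M_def using meas by (subst emeasure_density) auto
  also have "\<dots> = (\<integral>\<^sup>+ t. ennreal (herglotz_density f r t) \<partial>lborel)"
    by (intro nn_integral_cong) (auto simp: herglotz_density_def indicator_def)
  finally show "measure M {-1<..1} = 1" using em by (simp add: measure_def)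
qed

lemma circle_prob_distr:
  assumes "prob_space M" "g \<in> borel_measurable M" "\<And>x. g x \<in> \<T>"
  shows "circle_prob (distr M borel_circle g)"
    and "mom (distr M borel_circle g) n = (\<integral>t. g t ^ n \<partial>M)"
proof -
  have g: "g \<in> M \<rightarrow>\<^sub>M borel_circle"
    unfolding borel_circle_def using assms(2,3) by (intro measurable_restrict_space2) auto
  show cp: "circle_prob (distr M borel_circle g)"
    unfolding circle_prob_def using prob_space.prob_space_distr[OF assms(1) g] by simp
  have "(\<lambda>x::complex. x ^ n) \<in> borel_measurable borel_circle"
    unfolding borel_circle_def by (intro measurable_restrict_space1) auto
  then show "mom (distr M borel_circle g) n = (\<integral>t. g t ^ n \<partial>M)"
    unfolding mom_def by (rule integral_distr[OF g])
qed

text \<open>The Cayley transform \<open>f\<close> of \<open>h\<close> has positive real part and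
  value \<open>1\<close> at \<open>0\<close>, so its real part on smaller circles is a probability
  density. A weak limit as the radii tend to \<open>1\<close> has half the Taylor coefficients of
  \<open>f\<close> as moments, whence \<open>f = 1 + 2 * psi \<rho>\<close>, and the inverse Cayley
  transform returns \<open>h\<close>.\<close>

theorem ex_circle_prob_eta:
  assumes h: "h holomorphic_on \<D>" "h 0 = 0" "\<And>z. z \<in> \<D> \<Longrightarrow> h z \<in> \<D>"
  obtains \<rho> where "circle_prob \<rho>" "\<And>z. z \<in> \<D> \<Longrightarrow> eta \<rho> z = h z"
proof -
  define f where "f z = (1 + h z) / (1 - h z)" for z
  have h1: "1 - h z \<noteq> 0" if "z \<in> \<D>" for z using h(3)[OF that] by auto
  have f1: "f holomorphic_on \<D>" unfolding f_def by (intro holomorphic_intros h h1)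
  have f2: "f 0 = 1" by (simp add: f_def h)
  have f3: "Re (f z) > 0" if "z \<in> \<D>" for z
  proof -
    let ?w = "h z"
    have "(Re ?w)\<^sup>2 + (Im ?w)\<^sup>2 < 1"
      using h(3)[OF that] power_strict_mono[of "norm ?w" 1 2] by (simp add: cmod_power2)
    moreover have "(cmod (1 - ?w))\<^sup>2 > 0" using h1[OF that] by simp
    ultimately show ?thesis
      unfolding f_def by (simp add: Re_divide' power2_eq_square algebra_simps divide_pos_pos)
  qed
  \<comment> \<open>The shift by \<open>2\<close> keeps the first radius positive.\<close>
  define r :: "nat \<Rightarrow> real" where "r k = 1 - 1 / (k + 2)" for k
  have r: "0 < r k" "r k < 1" for k by (auto simp: r_def field_simps)
  define M where "M k = density lborel (\<lambda>t. ennreal (herglotz_density f (r k) t))" for k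
  have M: "real_distribution (M k)" "measure (M k) {-1<..1} = 1"
    "(\<integral>t. cis (- (2 * pi * t)) ^ n \<partial>M k) =
      (if n = 0 then 1 else of_real (r k) ^ n * (deriv ^^ n) f 0 / (2 * fact n))" for k n
    unfolding M_def
    using herglotz_real_distribution[OF f1 f2 f3 r] herglotz_measure_Icc[OF f1 f2 f3 r]
      herglotz_integral[OF f1 f2 f3 r] by auto
  \<comment> \<open>One bounded interval carries the full mass of every \<open>M k\<close>; its left
    end \<open>-1\<close> lets the half-open interval contain \<open>0\<close>.\<close>
  have "tight M"
    unfolding tight_def
  proof (intro conjI allI impI M(1))
    fix \<epsilon> :: real assume "\<epsilon> > 0"
    then show "\<exists>a b. a < b \<and> (\<forall>n. measure (M n) {a<..b} > 1 - \<epsilon>)"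
      using M(2) by (intro exI[of _ "-1"] exI[of _ 1]) auto
  qed
  then obtain s N where s: "strict_mono (s :: nat \<Rightarrow> nat)" "real_distribution N" "weak_conv_m (M \<circ> id \<circ> s) N"
    using tight_imp_convergent_subsubsequence[of M id] by (auto simp: strict_mono_id)
  define \<rho> where "\<rho> = distr N borel_circle (\<lambda>t. cis (- (2 * pi * t)))"
  interpret N: real_distribution N by (rule s(2))
  have ccont: "isCont (\<lambda>t. cis (- (2 * pi * t)) ^ n) t" for n t
    unfolding cis_conv_exp by (intro continuous_intros)
  have meas: "(\<lambda>t. cis (- (2 * pi * t))) \<in> borel_measurable N"
    using borel_measurable_continuous_onI[of "\<lambda>t. cis (- (2 * pi * t))"]
    by (auto simp: cis_conv_exp intro!: continuous_intros)
  have \<rho>: "circle_prob \<rho>" "mom \<rho> n = (\<integral>t. cis (- (2 * pi * t)) ^ n \<partial>N)" for n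
    unfolding \<rho>_def using circle_prob_distr[OF N.prob_space_axioms meas] by auto
  have mom: "mom \<rho> n = (deriv ^^ n) f 0 / (2 * fact n)" if "n > 0" for n
  proof -
    have "(\<lambda>k. \<integral>t. cis (- (2 * pi * t)) ^ n \<partial>(M \<circ> id \<circ> s) k) \<longlonglongrightarrow> (\<integral>t. cis (- (2 * pi * t)) ^ n \<partial>N)"
      using M(1) by (intro weak_conv_imp_integral_bdd_continuous_conv[OF _ s(2,3), where B=1] ccont)
        (auto simp: norm_power)
    then have "(\<lambda>k. of_real (r (s k)) ^ n * (deriv ^^ n) f 0 / (2 * fact n)) \<longlonglongrightarrow> mom \<rho> n"
      using that by (simp add: M(3) \<rho>(2))
    moreover have "r \<longlonglongrightarrow> 1" unfolding r_def by real_asymp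
    from LIMSEQ_subseq_LIMSEQ[OF this s(1)] have rs: "(\<lambda>k. r (s k)) \<longlonglongrightarrow> 1" by (simp add: o_def)
    then have "(\<lambda>k. of_real (r (s k)) ^ n * (deriv ^^ n) f 0 / (2 * fact n)) \<longlonglongrightarrow>
        of_real 1 ^ n * (deriv ^^ n) f 0 / (2 * fact n)"
      by (intro tendsto_intros rs) auto
    ultimately show ?thesis using LIMSEQ_unique by fastforce
  qed
  have "eta \<rho> z = h z" if z: "z \<in> \<D>" for z
  proof -
    have "(\<lambda>n. (deriv ^^ n) f 0 / fact n * z ^ n) sums f z"
      using holomorphic_power_series[OF f1, of z] z by simp
    then have "(\<lambda>n. (deriv ^^ Suc n) f 0 / fact (Suc n) * z ^ Suc n) sums (f z - 1)"
      by (subst sums_Suc_iff) (simp add: f2)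
    from sums_divide[OF this, of 2]
    have "(\<lambda>n. mom \<rho> (Suc n) * z ^ Suc n) sums ((f z - 1) / 2)"
      by (simp add: mom mult_ac del: fact_Suc power_Suc funpow.simps)
    with psi_sums[OF \<rho>(1) z] have "psi \<rho> z = (f z - 1) / 2" by (rule sums_unique2)
    also have "\<dots> = h z / (1 - h z)" using h1[OF z] by (simp add: f_def field_simps)
    finally have p: "psi \<rho> z = h z / (1 - h z)" .
    then have "1 + psi \<rho> z = 1 / (1 - h z)" using h1[OF z] by (simp add: field_simps)
    then show ?thesis unfolding eta_def using h1[OF z] by (simp add: p)
  qed
  with \<rho>(1) show ?thesis by (rule that)
qed

section \<open>Haar measure and well-definedness of the convolution\<close>

lemma circle_prob_haar: "circle_prob haar_circle"
  and mom_haar: "n > 0 \<Longrightarrow> mom haar_circle n = 0"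
proof -
  let ?U = "uniform_measure lborel {0..2 * pi}"
  have ps: "prob_space ?U" by (rule prob_space_uniform_measure) auto
  have meas: "cis \<in> borel_measurable ?U"
    using borel_measurable_continuous_onI[of cis]
    by (auto simp: cis_conv_exp[abs_def] uniform_measure_def intro!: continuous_intros)
  show "circle_prob haar_circle"
    unfolding haar_circle_def by (rule circle_prob_distr(1)[OF ps meas]) simp
  assume n: "n > 0"
  have mt: "mom haar_circle n = (\<integral>t. cis t ^ n \<partial>?U)"
    unfolding haar_circle_def by (rule circle_prob_distr(2)[OF ps meas]) simp
  have cm: "(\<lambda>t. cis t ^ n) \<in> borel_measurable lborel"
    using borel_measurable_continuous_onI[of "\<lambda>t. cis t ^ n"] by (auto simp: cis_conv_exp intro!: continuous_intros)
  have int: "set_integrable lborel {0..2*pi} (\<lambda>t. cis t ^ n)"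
    by (intro borel_integrable_atLeastAtMost') (auto simp: cis_conv_exp intro!: continuous_intros)
  have "((\<lambda>t. cis t ^ n) has_integral (cis (2*pi) ^ n / (\<i> * n) - cis 0 ^ n / (\<i> * n))) {0..2*pi}"
  proof (rule fundamental_theorem_of_calculus)
    fix x :: real
    have "((\<lambda>z. exp (\<i> * n * z) / (\<i> * n)) has_field_derivative exp (\<i> * n * x)) (at (of_real x))"
      using n by (auto intro!: derivative_eq_intros)
    from has_vector_derivative_real_field[OF this]
    have "((\<lambda>t. exp (\<i> * n * of_real t) / (\<i> * n)) has_vector_derivative exp (\<i> * n * x)) (at x within {0..2*pi})" .
    moreover have "exp (\<i> * n * of_real t) = cis t ^ n" for t
      unfolding cis_conv_exp exp_of_nat_mult[symmetric] by (simp add: mult_ac)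
    ultimately show "((\<lambda>t. cis t ^ n / (\<i> * n)) has_vector_derivative cis x ^ n) (at x within {0..2*pi})"
      by simp
  qed auto
  then have z: "(LINT t:{0..2*pi}|lborel. cis t ^ n) = 0"
    unfolding set_borel_integral_eq_integral(2)[OF int] by (intro integral_unique) simp
  have "(\<integral>t. cis t ^ n \<partial>?U) = (\<integral>t. (indicator {0..2*pi} t / (2*pi)) *\<^sub>R cis t ^ n \<partial>lborel)"
    unfolding uniform_measure_def
  proof (subst integral_density[symmetric, OF cm])
    show "(\<integral>t. cis t ^ n \<partial>density lborel (\<lambda>x. indicator {0..2*pi} x / emeasure lborel {0..2*pi})) =
      (\<integral>t. cis t ^ n \<partial>density lborel (\<lambda>x. ennreal (indicator {0..2*pi} x / (2*pi))))"
      by (rule arg_cong[where f="\<lambda>d. \<integral>t. cis t ^ n \<partial>density lborel d"])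
        (auto simp: fun_eq_iff indicator_def divide_ennreal simp flip: ennreal_1)
  qed auto
  also have "\<dots> = (1 / (2*pi)) *\<^sub>R (LINT t:{0..2*pi}|lborel. cis t ^ n)"
    unfolding set_lebesgue_integral_def by (subst integral_scaleR_right[symmetric]) simp
  finally show "mom haar_circle n = 0" using z mt by simp
qed

text \<open>Existence comes from the Herglotz representation of the composed self-map and uniqueness
  from the fact that \<open>eta\<close> determines the measure; together they justify the definite
  description.\<close>

lemma mono_conv_props:
  assumes "circle_prob \<mu>" "circle_prob \<nu>"
  shows "circle_prob (mono_conv \<mu> \<nu>)" "z \<in> \<D> \<Longrightarrow> eta (mono_conv \<mu> \<nu>) z = eta \<mu> (eta \<nu> z)"
proof -
  have m: "eta \<nu> ` \<D> \<subseteq> \<D>" using norm_eta_less_1[OF assms(2)] by auto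
  have "(\<lambda>z. eta \<mu> (eta \<nu> z)) holomorphic_on \<D>"
    using holomorphic_on_compose_gen[OF eta_holomorphic[OF assms(2)] eta_holomorphic[OF assms(1)] m]
    by (simp add: o_def)
  then obtain \<rho> where \<rho>: "circle_prob \<rho>" "\<And>z. z \<in> \<D> \<Longrightarrow> eta \<rho> z = eta \<mu> (eta \<nu> z)"
    using m norm_eta_less_1[OF assms(1)]
    by (elim ex_circle_prob_eta) (auto simp: image_subset_iff)
  have "\<exists>!\<rho>. circle_prob \<rho> \<and> (\<forall>z\<in>\<D>. eta \<rho> z = eta \<mu> (eta \<nu> z))"
    using \<rho> by (intro ex1I[of _ \<rho>]) (auto intro: circle_prob_eqI_eta)
  from theI'[OF this] show "circle_prob (mono_conv \<mu> \<nu>)"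
    "z \<in> \<D> \<Longrightarrow> eta (mono_conv \<mu> \<nu>) z = eta \<mu> (eta \<nu> z)"
    unfolding mono_conv_def by auto
qed

lemma mono_conv_upto_1: "mono_conv_upto m 1 = m 1"
  by (simp add: mono_conv_upto_def)

lemma mono_conv_upto_Suc:
  "k \<ge> 1 \<Longrightarrow> mono_conv_upto m (Suc k) = mono_conv (mono_conv_upto m k) (m (Suc k))"
  by (simp add: mono_conv_upto_def)

lemma mono_conv_upto_circle_prob:
  assumes "\<And>j. j \<in> {1..k} \<Longrightarrow> circle_prob (m j)" "k \<ge> 1"
  shows "circle_prob (mono_conv_upto m k)"
  using assms(2,1)
proof (induction k rule: dec_induct)
  case (step k)
  then show ?case
    by (simp add: mono_conv_upto_Suc mono_conv_props)
qed (simp add: mono_conv_upto_1[unfolded One_nat_def])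

section \<open>Limits of infinitesimal arrays\<close>

text \<open>A coincidence of values at \<open>z \<noteq> w\<close> makes the integral of the
  difference quotient kernel \<open>k\<close> vanish. But \<open>norm (k 1) \<ge> 1 / 4\<close>,
  while \<open>k x\<close> differs from \<open>k 1\<close> by at most
  \<open>2 * norm (x - 1) / (1 - r) ^ 4\<close>; this explains the constant
  \<open>8 = 4 * 2\<close>.\<close>

lemma psi_inj_on_ball_near_1:
  assumes \<mu>: "circle_prob \<mu>" and r: "0 < r" "r < 1"
    and small: "8 * (\<integral>x. norm (x - 1) \<partial>\<mu>) < (1 - r) ^ 4"
  shows "inj_on (psi \<mu>) (ball 0 r)"
proof (rule inj_onI, rule ccontr)
  interpret prob_space \<mu> using \<mu> by (rule circle_prob_space)
  note sp = space_circle_prob[OF \<mu>]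
  fix z w assume zw: "z \<in> ball 0 r" "w \<in> ball 0 r" "psi \<mu> z = psi \<mu> w" "z \<noteq> w"
  have D: "z \<in> \<D>" "w \<in> \<D>" using zw r by auto
  define k where "k x = x / ((1 - x * z) * (1 - x * w))" for x
  have nz: "1 - x * z \<noteq> 0" "1 - x * w \<noteq> 0" if "x \<in> \<T>" for x
    using circle_times_disc_neq_1 D that by auto
  have kc: "continuous_on \<T> k"
    unfolding k_def using nz by (intro continuous_intros) auto
  have "psi \<mu> z - psi \<mu> w = (\<integral>x. x * z / (1 - x * z) - x * w / (1 - x * w) \<partial>\<mu>)"
    unfolding psi_def
    by (intro Bochner_Integration.integral_diff[symmetric] circle_prob_integrable[OF \<mu>] continuous_on_psi_kernel D)
  also have "\<dots> = (\<integral>x. (z - w) * k x \<partial>\<mu>)"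
  proof (rule Bochner_Integration.integral_cong[OF refl])
    fix x assume "x \<in> space \<mu>"
    then have "1 - x * z \<noteq> 0" "1 - x * w \<noteq> 0" using nz sp by auto
    then show "x * z / (1 - x * z) - x * w / (1 - x * w) = (z - w) * k x"
      unfolding k_def by (simp add: divide_simps) (simp add: algebra_simps)
  qed
  also have "\<dots> = (z - w) * (\<integral>x. k x \<partial>\<mu>)" by simp
  finally have int0: "(\<integral>x. k x \<partial>\<mu>) = 0" using zw by simp
  have low: "norm (1 - x * u) \<ge> 1 - r" if "x \<in> \<T>" "u \<in> ball 0 r" for x u
  proof -
    have "norm (x * u) \<le> r" using that by (simp add: norm_mult)
    then show ?thesis using norm_triangle_ineq2[of 1 "x * u"] by simp
  qed
  have one: "(1::complex) \<in> \<T>" by simp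
  have "norm (k 1) = 1 / (norm (1 - z) * norm (1 - w))"
    by (simp add: k_def norm_divide norm_mult)
  moreover have "norm (1 - z) * norm (1 - w) \<le> 2 * 2"
    using D norm_triangle_ineq4[of 1 z] norm_triangle_ineq4[of 1 w] by (intro mult_mono) auto
  moreover have "norm (1 - z) * norm (1 - w) > 0" using nz[OF one] by simp
  ultimately have k1: "norm (k 1) \<ge> 1 / 4"
    by (simp add: field_simps)
  have kd: "norm (k x - k 1) \<le> 2 * norm (x - 1) / (1 - r) ^ 4" if x: "x \<in> \<T>" for x
  proof -
    \<comment> \<open>no\<close>
    let ?den = "(1 - x * z) * (1 - x * w) * ((1 - z) * (1 - w))"
    have "k x - k 1 = (x - 1) * (1 - x * z * w) / ?den"
      unfolding k_def using nz[OF x] nz[OF one] by (simp add: divide_simps) (simp add: algebra_simps)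
    then have "norm (k x - k 1) = norm (x - 1) * norm (1 - x * z * w) / norm ?den"
      by (simp add: norm_divide norm_mult)
    also have "\<dots> \<le> norm (x - 1) * 2 / (1 - r) ^ 4"
    proof (rule frac_le)
      have "norm (x * z * w) \<le> 1" using x D by (simp add: norm_mult mult_le_one)
      then have "norm (1 - x * z * w) \<le> 2" using norm_triangle_ineq4[of 1 "x * z * w"] by simp
      then show "norm (x - 1) * norm (1 - x * z * w) \<le> norm (x - 1) * 2" by (intro mult_left_mono) auto
      have "(1 - r) * (1 - r) * ((1 - r) * (1 - r)) \<le>
          norm (1 - x * z) * norm (1 - x * w) * (norm (1 - 1 * z) * norm (1 - 1 * w))"
        using r x zw one by (intro mult_mono low mult_nonneg_nonneg) auto
      then show "(1 - r) ^ 4 \<le> norm ?den"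
        by (simp add: norm_mult power4_eq_xxxx mult.assoc)
    qed (use r in auto)
    finally show ?thesis by (simp add: mult.commute)
  qed
  have "(\<integral>x. k x - k 1 \<partial>\<mu>) = - k 1"
    using int0 circle_prob_integrable[OF \<mu> kc] by (simp add: prob_space)
  then have "norm (k 1) = norm (\<integral>x. k x - k 1 \<partial>\<mu>)" by simp
  also have "\<dots> \<le> (\<integral>x. norm (k x - k 1) \<partial>\<mu>)" by (rule integral_norm_bound)
  also have "\<dots> \<le> (\<integral>x. 2 * norm (x - 1) / (1 - r) ^ 4 \<partial>\<mu>)"
    using kd r by (intro integral_mono circle_prob_integrable[OF \<mu>] continuous_intros kc) (auto simp: sp)
  also have "\<dots> = 2 * (\<integral>x. norm (x - 1) \<partial>\<mu>) / (1 - r) ^ 4" by simp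
  also have "\<dots> < 1 / 4" using small r by (simp add: field_simps)
  finally show False using k1 by simp
qed

section \<open>Concentration near \<open>1\<close> in terms of arcs, mean distance and first
  moment\<close>

lemma arc_complement_measurable:
  assumes "circle_prob \<mu>" shows "\<T> - cis ` {-\<delta>..\<delta>} \<in> sets \<mu>"
proof -
  have "compact (cis ` {-\<delta>..\<delta>})"
    by (intro compact_continuous_image) (auto simp: cis_conv_exp[abs_def] intro!: continuous_intros)
  then have "- (cis ` {-\<delta>..\<delta>}) \<in> sets borel" by (auto dest: compact_imp_closed)
  then show ?thesis
    using assms by (auto simp: circle_prob_def borel_circle_def sets_restrict_space)
qed

text \<open>On the arc the chord is no longer than the angle, hence at most \<open>\<delta>\<close>;
  off the arc it is at most the diameter \<open>2\<close>.\<close>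

lemma integral_dist_1_le:
  assumes \<mu>: "circle_prob \<mu>" and "0 < \<delta>"
  shows "(\<integral>x. norm (x - 1) \<partial>\<mu>) \<le> \<delta> + 2 * measure \<mu> (\<T> - cis ` {-\<delta>..\<delta>})"
proof -
  interpret prob_space \<mu> using \<mu> by (rule circle_prob_space)
  let ?A = "\<T> - cis ` {-\<delta>..\<delta>}"
  have A: "?A \<in> sets \<mu>" by (rule arc_complement_measurable[OF \<mu>])
  then have iA: "integrable \<mu> (indicat_real ?A)"
    by (intro integrable_real_indicator) (auto simp: emeasure_eq_measure)
  have "(\<integral>x. norm (x - 1) \<partial>\<mu>) \<le> (\<integral>x. \<delta> + 2 * indicator ?A x \<partial>\<mu>)"
  proof (rule integral_mono)
    fix x assume "x \<in> space \<mu>"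
    then have x: "x \<in> \<T>" using space_circle_prob[OF \<mu>] by simp
    show "norm (x - 1) \<le> \<delta> + 2 * indicator ?A x"
    proof (cases "x \<in> cis ` {-\<delta>..\<delta>}")
      case True
      then obtain t where t: "x = cis t" "\<bar>t\<bar> \<le> \<delta>" by (auto simp: abs_le_iff)
      have "norm (cis t - 1) = 2 * \<bar>sin (t / 2)\<bar>" by (simp add: cis_conv_exp dist_exp_i_1)
      also have "\<dots> \<le> \<bar>t\<bar>" using abs_sin_x_le_abs_x[of "t / 2"] by simp
      finally show ?thesis using t True by simp
    next
      case False
      then show ?thesis using x norm_triangle_ineq4[of x 1] \<open>0 < \<delta>\<close> by simp
    qed
  next
    show "integrable \<mu> (\<lambda>x. norm (x - 1))"
      by (intro circle_prob_integrable[OF \<mu>] continuous_intros)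
  qed (use iA in simp)
  also have "\<dots> = \<delta> + 2 * measure \<mu> ?A"
    using iA prob_space by (simp add: space_circle_prob[OF \<mu>] Int_absorb2)
  finally show ?thesis .
qed

text \<open>Markov's inequality for the nonnegative function \<open>1 - Re x\<close>, which exceeds
  \<open>1 - cos \<delta>\<close> off the arc.\<close>

lemma arc_complement_measure_le:
  assumes \<mu>: "circle_prob \<mu>" and \<delta>: "0 < \<delta>" "\<delta> < pi"
  shows "measure \<mu> (\<T> - cis ` {-\<delta>..\<delta>}) \<le> (1 - Re (mom \<mu> 1)) / (1 - cos \<delta>)"
proof -
  interpret prob_space \<mu> using \<mu> by (rule circle_prob_space)
  let ?A = "\<T> - cis ` {-\<delta>..\<delta>}"
  have A: "?A \<in> sets \<mu>" by (rule arc_complement_measurable[OF \<mu>])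
  then have iA: "integrable \<mu> (indicat_real ?A)"
    by (intro integrable_real_indicator) (auto simp: emeasure_eq_measure)
  have c: "cos \<delta> < 1" using cos_monotone_0_pi[of 0 \<delta>] \<delta> by simp
  have i: "integrable \<mu> (\<lambda>x. x)" by (intro circle_prob_integrable[OF \<mu>]) auto
  have "measure \<mu> ?A = (\<integral>x. indicator ?A x \<partial>\<mu>)"
    using A by (simp add: space_circle_prob[OF \<mu>] Int_absorb2)
  also have "\<dots> \<le> (\<integral>x. (1 - Re x) / (1 - cos \<delta>) \<partial>\<mu>)"
  proof (rule integral_mono)
    fix x assume "x \<in> space \<mu>"
    then have x: "norm x = 1" using space_circle_prob[OF \<mu>] by simp
    show "indicator ?A x \<le> (1 - Re x) / (1 - cos \<delta>)"
    proof (cases "x \<in> ?A")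
      case True
      have e: "x = cis (Arg x)" using x by (metis cis_Arg norm_zero sgn_eq zero_neq_one div_by_1 of_real_1)
      have "\<not> \<bar>Arg x\<bar> \<le> \<delta>"
      proof
        assume "\<bar>Arg x\<bar> \<le> \<delta>"
        then have "cis (Arg x) \<in> cis ` {-\<delta>..\<delta>}" by (intro imageI) (simp add: abs_le_iff)
        then have "x \<in> cis ` {-\<delta>..\<delta>}" using e by simp
        then show False using True by simp
      qed
      then have "cos \<bar>Arg x\<bar> < cos \<delta>"
        using \<delta> Arg_bounded[of x] by (intro cos_monotone_0_pi) auto
      moreover have "Re x = cos (Arg x)" using e by (metis cis.simps(1))
      ultimately show ?thesis using c True by (simp add: field_simps)
    next
      case False
      have "Re x \<le> 1" using x complex_Re_le_cmod[of x] by simp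
      then show ?thesis using False c by simp
    qed
  qed (use iA i in simp_all)
  also have "\<dots> = (1 - Re (mom \<mu> 1)) / (1 - cos \<delta>)"
    using i by (simp add: mom_def prob_space)
  finally show ?thesis .
qed

text \<open>By the Schwarz lemma each \<open>eta\<close> maps \<open>ball 0 r\<close> into itself,
  so injectivity of the factors on this one ball passes to the composition.\<close>

lemma inj_on_eta_mono_conv_upto:
  assumes "\<And>j. j \<in> {1..k} \<Longrightarrow> circle_prob (m j)" "k \<ge> 1"
    and "0 < r" "r < 1" "\<And>j. j \<in> {1..k} \<Longrightarrow> inj_on (psi (m j)) (ball 0 r)"
  shows "inj_on (eta (mono_conv_upto m k)) (ball 0 r)"
  using assms(2,1,5)
proof (induction k rule: dec_induct)
  case base
  have "ball 0 r \<subseteq> \<D>" using assms(4) by auto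
  then show ?case using base inj_on_eta_iff[of "m 1" "ball 0 r"] by (simp add: mono_conv_upto_1[unfolded One_nat_def])
next
  case (step k)
  have sub: "ball 0 r \<subseteq> \<D>" using assms(4) by auto
  have cp: "circle_prob (mono_conv_upto m k)" "circle_prob (m (Suc k))"
    using step by (auto intro: mono_conv_upto_circle_prob)
  have inj: "inj_on (eta (m (Suc k))) (ball 0 r)"
    using step.prems inj_on_eta_iff[OF cp(2) sub] by simp
  have "eta (m (Suc k)) ` ball 0 r \<subseteq> ball 0 r"
  proof safe
    fix z :: complex assume z: "z \<in> ball 0 r"
    then have "norm (eta (m (Suc k)) z) \<le> norm z" using sub by (intro norm_eta_le cp) auto
    then show "eta (m (Suc k)) z \<in> ball 0 r" using z by simp
  qed
  with step have "inj_on (eta (mono_conv_upto m k)) (eta (m (Suc k)) ` ball 0 r)"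
    by (auto intro: inj_on_subset)
  from comp_inj_on[OF inj this]
  have "inj_on (\<lambda>z. eta (mono_conv_upto m k) (eta (m (Suc k)) z)) (ball 0 r)"
    by (simp add: o_def)
  moreover have "eta (mono_conv_upto m (Suc k)) z = eta (mono_conv_upto m k) (eta (m (Suc k)) z)"
    if "z \<in> ball 0 r" for z
    using mono_conv_props(2)[OF cp] that sub step.hyps by (auto simp: mono_conv_upto_Suc)
  ultimately show ?case by (subst inj_on_cong)
qed

section \<open>Injectivity of the transform of a weak limit\<close>

lemma weak_conv_circle_psi:
  assumes w: "weak_conv_circle M \<mu>" and M: "\<And>n. n \<ge> n0 \<Longrightarrow> circle_prob (M n)"
    and \<mu>: "circle_prob \<mu>" and z: "z \<in> \<D>"
  shows "(\<lambda>n. psi (M n) z) \<longlonglongrightarrow> psi \<mu> z"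
proof -
  let ?k = "\<lambda>x. x * z / (1 - x * z)"
  have k: "continuous_on \<T> ?k" by (rule continuous_on_psi_kernel[OF z])
  have parts: "psi \<nu> z = Complex (\<integral>x. Re (?k x) \<partial>\<nu>) (\<integral>x. Im (?k x) \<partial>\<nu>)" if "circle_prob \<nu>" for \<nu>
    unfolding psi_def using circle_prob_integrable[OF that k] by (intro complex_eqI) simp_all
  have "(\<lambda>n. Complex (\<integral>x. Re (?k x) \<partial>M n) (\<integral>x. Im (?k x) \<partial>M n)) \<longlonglongrightarrow> psi \<mu> z"
    unfolding parts[OF \<mu>]
    using w k unfolding weak_conv_circle_def
    by (intro tendsto_Complex) (auto intro!: continuous_intros)
  then show ?thesis
    by (rule Lim_transform_eventually)
      (use M parts in \<open>auto simp: eventually_sequentially intro!: exI[of _ n0]\<close>)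
qed

lemma norm_psi_le:
  assumes "circle_prob \<mu>" "norm z \<le> r" "r < 1"
  shows "norm (psi \<mu> z) \<le> 1 / (1 - r)"
  unfolding psi_def
proof (rule circle_prob_integral_norm_le[OF assms(1) continuous_on_psi_kernel])
  show "z \<in> \<D>" using assms by simp
  fix x :: complex assume "x \<in> \<T>"
  then have x: "norm (x * z) = norm z" by (simp add: norm_mult)
  then have "1 - r \<le> norm (1 - x * z)"
    using assms norm_triangle_ineq2[of 1 "x * z"] by simp
  then show "norm (x * z / (1 - x * z)) \<le> 1 / (1 - r)"
    unfolding norm_divide x using assms by (intro frac_le) auto
qed

text \<open>All transforms share a bound on each compact subset of the disc, so Montel's theorem
  turns pointwise convergence into locally uniform convergence along a subsequence, and Hurwitz'
  theorem applies.\<close>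

lemma psi_limit_inj_on:
  assumes M: "\<And>n. circle_prob (M n)" and \<mu>: "circle_prob \<mu>"
    and lim: "\<And>z. z \<in> \<D> \<Longrightarrow> (\<lambda>n. psi (M n) z) \<longlonglongrightarrow> psi \<mu> z"
    and inj: "\<And>n. inj_on (psi (M n)) (ball 0 r)" and r: "0 < r" "r < 1"
    and nc: "\<not> psi \<mu> constant_on ball 0 r"
  shows "inj_on (psi \<mu>) (ball 0 r)"
proof -
  have sub: "ball 0 r \<subseteq> \<D>" using r by auto
  have bdd: "\<exists>B. \<forall>h\<in>psi ` Collect circle_prob. \<forall>z\<in>K. norm (h z) \<le> B" if K: "compact K" "K \<subseteq> \<D>" for K
  proof (cases "K = {}")
    case False
    have "continuous_on K norm" by (intro continuous_intros)
    from continuous_attains_sup[OF K(1) False this]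
    obtain w where w: "w \<in> K" "\<And>z. z \<in> K \<Longrightarrow> norm z \<le> norm w" by blast
    show ?thesis
      using norm_psi_le w K(2) by (intro exI[of _ "1 / (1 - norm w)"]) auto
  qed auto
  obtain g s where g: "g holomorphic_on \<D>" "strict_mono (s :: nat \<Rightarrow> nat)"
      "\<And>x. x \<in> \<D> \<Longrightarrow> (\<lambda>n. psi (M (s n)) x) \<longlonglongrightarrow> g x"
      "\<And>K. compact K \<Longrightarrow> K \<subseteq> \<D> \<Longrightarrow> uniform_limit K ((\<lambda>n. psi (M n)) \<circ> s) g sequentially"
    by (rule Montel[of \<D> "psi ` Collect circle_prob" "\<lambda>n. psi (M n)", OF _ _ bdd])
      (use M psi_holomorphic in auto)
  have geq: "g z = psi \<mu> z" if "z \<in> \<D>" for z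
    using LIMSEQ_unique[OF g(3)[OF that]] LIMSEQ_subseq_LIMSEQ[OF lim[OF that] g(2)] by (simp add: o_def)
  have "inj_on g (ball 0 r)"
  proof (rule Hurwitz_injective[where \<F> = "(\<lambda>n. psi (M n)) \<circ> s"])
    show "\<not> g constant_on ball 0 r"
      using nc geq sub unfolding constant_on_def by (metis subsetD)
    show "((\<lambda>n. psi (M n)) \<circ> s) n holomorphic_on ball 0 r" for n
      using psi_holomorphic[OF M] sub by (auto intro: holomorphic_on_subset)
    show "g holomorphic_on ball 0 r" using g(1) sub by (rule holomorphic_on_subset)
    show "uniform_limit K ((\<lambda>n. psi (M n)) \<circ> s) g sequentially" if "compact K" "K \<subseteq> ball 0 r" for K
      using g(4)[OF that(1)] that(2) sub by blast
  qed (use inj in auto)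
  then show ?thesis using inj_on_cong[of "ball 0 r" g "psi \<mu>"] geq sub by blast
qed

lemma limit_imp_univalent_or_haar:
  assumes \<mu>: "circle_prob \<mu>" and "limit_of_infinitesimal_array \<mu>"
  shows "univalent_on (psi \<mu>) \<D> \<or> \<mu> = haar_circle"
proof -
  obtain k m where arr: "infinitesimal_array k m"
    and wc: "weak_conv_circle (\<lambda>n. mono_conv_upto (m n) (k n)) \<mu>"
    using assms(2) by (auto simp: limit_of_infinitesimal_array_def)
  have k1: "k n \<ge> 1" if "n \<ge> 1" for n using arr that by (simp add: infinitesimal_array_def)
  have cp: "circle_prob (m n j)" if "n \<ge> 1" "j \<in> {1..k n}" for n j
    using arr that by (simp add: infinitesimal_array_def)
  let ?M = "\<lambda>n. mono_conv_upto (m n) (k n)"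
  have cpM: "circle_prob (?M n)" if "n \<ge> 1" for n
    using that k1 cp by (intro mono_conv_upto_circle_prob) auto
  have inj: "inj_on (psi \<mu>) (ball 0 r)" if r: "0 < r" "r < 1" and nc: "\<not> psi \<mu> constant_on ball 0 r" for r
  proof -
    \<comment> \<open>The injectivity criterion asks for a mean distance to \<open>1\<close> below
      \<open>e\<close>. With \<open>\<delta> = e / 2\<close> and masses below \<open>e / 4\<close>
      off the arc, it is less than \<open>e / 2 + 2 * (e / 4) = e\<close>.\<close>
    define e where "e = (1 - r) ^ 4 / 8"
    have "(1 - r) ^ 4 \<le> 1" using r by (intro power_le_one) auto
    then have e: "0 < e" "e < 1" using r by (auto simp: e_def)
    define \<delta> where "\<delta> = e / 2"
    have "\<delta> \<in> {0<..<pi}" using e pi_gt3 by (simp add: \<delta>_def)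
    then have "(\<lambda>n. SUP j\<in>{1..k n}. measure (m n j) (\<T> - cis ` {-\<delta>..\<delta>})) \<longlonglongrightarrow> 0"
      using arr by (simp add: infinitesimal_array_def)
    then have "\<forall>\<^sub>F n in sequentially. (SUP j\<in>{1..k n}. measure (m n j) (\<T> - cis ` {-\<delta>..\<delta>})) < e / 4"
      using e by (intro order_tendstoD(2)) auto
    then obtain N where N: "\<And>n. n \<ge> N \<Longrightarrow> (SUP j\<in>{1..k n}. measure (m n j) (\<T> - cis ` {-\<delta>..\<delta>})) < e / 4"
      by (auto simp: eventually_sequentially)
    \<comment> \<open>Starting at \<open>N + 1\<close> excludes row \<open>0\<close>, which the
      array does not constrain.\<close>
    have inj_n: "inj_on (psi (?M n)) (ball 0 r)" if n: "n \<ge> N + 1" for n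
    proof -
      have "inj_on (psi (m n j)) (ball 0 r)" if j: "j \<in> {1..k n}" for j
      proof (rule psi_inj_on_ball_near_1[OF cp r])
        let ?f = "\<lambda>j. measure (m n j) (\<T> - cis ` {-\<delta>..\<delta>})"
        have "?f j \<le> (SUP j\<in>{1..k n}. ?f j)"
          using j by (intro cSUP_upper) (auto intro!: bdd_above_finite)
        then have "?f j < e / 4" using N[of n] n by simp
        then have "(\<integral>x. norm (x - 1) \<partial>m n j) < e"
          using integral_dist_1_le[OF cp, of n j \<delta>] n j e by (simp add: \<delta>_def)
        then show "8 * (\<integral>x. norm (x - 1) \<partial>m n j) < (1 - r) ^ 4" by (simp add: e_def)
      qed (use n j in auto)
      then have "inj_on (eta (?M n)) (ball 0 r)"
        using n k1[of n] cp[of n] r by (intro inj_on_eta_mono_conv_upto) auto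
      moreover have "ball 0 r \<subseteq> \<D>" using r by auto
      ultimately show ?thesis using inj_on_eta_iff[OF cpM] n by simp
    qed
    show ?thesis
    proof (rule psi_limit_inj_on[OF _ \<mu> _ _ r nc])
      show "circle_prob (?M (n + (N + 1)))" for n by (rule cpM) simp
      show "inj_on (psi (?M (n + (N + 1)))) (ball 0 r)" for n by (rule inj_n) simp
      show "(\<lambda>n. psi (?M (n + (N + 1))) z) \<longlonglongrightarrow> psi \<mu> z" if "z \<in> \<D>" for z
        using weak_conv_circle_psi[OF wc cpM \<mu> that, of 1] by (rule LIMSEQ_ignore_initial_segment)
    qed
  qed
  show ?thesis
  proof (cases "psi \<mu> constant_on ball 0 (1/2)")
    case True
    then obtain c where c: "psi \<mu> z = c" if "z \<in> ball 0 (1/2)" for z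
      unfolding constant_on_def by blast
    have "mom \<mu> p = 0" if "p > 0" for p
    proof -
      \<comment> \<open>A constant \<open>psi\<close> is the case of dilation factor
        \<open>0\<close>.\<close>
      have "mom \<mu> p = 0 ^ p * mom \<mu> p"
      proof (rule moments_eq_if_psi_scaled[OF \<mu> \<mu>, of "1/2"])
        show "psi \<mu> z = psi \<mu> (0 * z)" if "z \<in> ball 0 (1/2)" for z
          using c[OF that] c[of 0] by simp
      qed (use that in auto)
      then show ?thesis using that by (simp add: zero_power)
    qed
    then show ?thesis using circle_prob_eqI_moments[OF \<mu> circle_prob_haar] mom_haar by simp
  next
    case False
    have "inj_on (psi \<mu>) \<D>"
    proof (rule inj_onI)
      fix x y assume xy: "x \<in> \<D>" "y \<in> \<D>" "psi \<mu> x = psi \<mu> y"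
      \<comment> \<open>Including \<open>1/2\<close> ensures that the ball chosen next contains the
        one on which \<open>psi \<mu>\<close> is known to be nonconstant.\<close>
      define s where "s = Max {1/2, norm x, norm y}"
      have "s < 1" "1/2 \<le> s" "norm x \<le> s" "norm y \<le> s" using xy by (auto simp: s_def)
      moreover then obtain r where r: "s < r" "r < 1" using dense by blast
      moreover have "ball (0::complex) (1/2) \<subseteq> ball 0 r" using calculation by (intro subset_ball) simp
      then have "\<not> psi \<mu> constant_on ball 0 r" using False constant_on_subset by blast
      ultimately show "x = y" using inj[of r] xy(3) by (simp add: inj_on_def)
    qed
    then show ?thesis using psi_holomorphic[OF \<mu>] by (simp add: univalent_on_def)
  qed
qed

section \<open>Conformal radius and slit domains\<close>

lemma norm_deriv_0_le_1:
  assumes "g holomorphic_on \<D>" "g 0 = 0" "g ` \<D> \<subseteq> \<D>"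
  shows "norm (deriv g 0) \<le> 1"
  using Schwarz_Lemma(2)[OF assms(1,2), of 0] assms(3) by (auto simp: image_subset_iff)

lemma deriv_compose_disc:
  assumes "f holomorphic_on \<D>" "\<phi> holomorphic_on \<D>" "\<phi> 0 = 0"
    and eq: "\<And>z. z \<in> \<D> \<Longrightarrow> f (\<phi> z) = g z"
  shows "deriv g 0 = deriv f 0 * deriv \<phi> 0"
proof -
  have "(f has_field_derivative deriv f 0) (at (\<phi> 0))" "(\<phi> has_field_derivative deriv \<phi> 0) (at 0)"
    using assms(1-3) by (auto intro!: holomorphic_derivI[of _ \<D>])
  from DERIV_chain2[OF this] have "((\<lambda>z. f (\<phi> z)) has_field_derivative deriv f 0 * deriv \<phi> 0) (at 0)" .
  then have "(g has_field_derivative deriv f 0 * deriv \<phi> 0) (at 0)"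
    by (rule has_field_derivative_transform_within_open[of _ _ _ \<D>]) (use eq in auto)
  then show ?thesis by (rule DERIV_imp_deriv)
qed

text \<open>The map \<open>\<phi>\<close> is \<open>g\<close> followed by the inverse of
  \<open>f\<close>, which is holomorphic on the image of \<open>f\<close>.\<close>

lemma subordination:
  assumes f: "f holomorphic_on \<D>" "inj_on f \<D>" "f 0 = 0"
    and g: "g holomorphic_on \<D>" "g 0 = 0" "g ` \<D> \<subseteq> f ` \<D>"
  obtains \<phi> where "\<phi> holomorphic_on \<D>" "\<phi> 0 = 0" "\<phi> ` \<D> \<subseteq> \<D>"
    "\<And>z. z \<in> \<D> \<Longrightarrow> f (\<phi> z) = g z" "deriv g 0 = deriv f 0 * deriv \<phi> 0"
proof -
  obtain h where h: "h holomorphic_on f ` \<D>" "\<And>z. z \<in> \<D> \<Longrightarrow> h (f z) = z"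
    using holomorphic_has_inverse[OF f(1) open_ball f(2)] by metis
  define \<phi> where "\<phi> = h \<circ> g"
  have a: "\<phi> holomorphic_on \<D>" unfolding \<phi>_def by (rule holomorphic_on_compose_gen[OF g(1) h(1) g(3)])
  have b: "\<phi> 0 = 0" using h(2)[of 0] by (simp add: \<phi>_def f g)
  have c: "\<phi> z \<in> \<D> \<and> f (\<phi> z) = g z" if z: "z \<in> \<D>" for z
  proof -
    obtain w where "w \<in> \<D>" "g z = f w" using g(3) z by blast
    then show ?thesis using h(2)[of w] by (simp add: \<phi>_def)
  qed
  show ?thesis
  proof (rule that[OF a b])
    show "deriv g 0 = deriv f 0 * deriv \<phi> 0" using c by (intro deriv_compose_disc f a b) auto
  qed (use c in auto)
qed

text \<open>For simply connected \<open>\<Omega>\<close> this is the conformal radius seen from \<open>0\<close>; the extremal form makes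
  sense, and is monotone, for every domain.\<close>

definition conf_rad :: "complex set \<Rightarrow> real"
  where "conf_rad \<Omega> = (SUP g\<in>{g. g holomorphic_on \<D> \<and> g 0 = 0 \<and> g ` \<D> \<subseteq> \<Omega>}. norm (deriv g 0))"

lemma conf_rad_upper:
  assumes "\<Omega> \<subseteq> \<D>" "g holomorphic_on \<D>" "g 0 = 0" "g ` \<D> \<subseteq> \<Omega>"
  shows "norm (deriv g 0) \<le> conf_rad \<Omega>"
  unfolding conf_rad_def
proof (rule cSUP_upper)
  show "g \<in> {g. g holomorphic_on \<D> \<and> g 0 = 0 \<and> g ` \<D> \<subseteq> \<Omega>}" using assms by simp
  show "bdd_above ((\<lambda>g. norm (deriv g 0)) ` {g. g holomorphic_on \<D> \<and> g 0 = 0 \<and> g ` \<D> \<subseteq> \<Omega>})"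
  proof (rule bdd_aboveI2)
    fix h assume "h \<in> {g. g holomorphic_on \<D> \<and> g 0 = 0 \<and> g ` \<D> \<subseteq> \<Omega>}"
    then have "h holomorphic_on \<D>" "h 0 = 0" "h ` \<D> \<subseteq> \<Omega>" by simp_all
    then show "norm (deriv h 0) \<le> 1" by (rule norm_deriv_0_le_1[OF _ _ subset_trans[OF _ assms(1)]])
  qed
qed

lemma conf_rad_least:
  assumes "0 \<in> \<Omega>"
    and "\<And>g. g holomorphic_on \<D> \<Longrightarrow> g 0 = 0 \<Longrightarrow> g ` \<D> \<subseteq> \<Omega> \<Longrightarrow> norm (deriv g 0) \<le> b"
  shows "conf_rad \<Omega> \<le> b"
  unfolding conf_rad_def
proof (rule cSUP_least)
  have "(\<lambda>_. 0) \<in> {g. g holomorphic_on \<D> \<and> g 0 = 0 \<and> g ` \<D> \<subseteq> \<Omega>}" using assms(1) by auto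
  then show "{g. g holomorphic_on \<D> \<and> g 0 = 0 \<and> g ` \<D> \<subseteq> \<Omega>} \<noteq> {}" by blast
qed (use assms(2) in auto)

lemma conf_rad_mono:
  assumes "0 \<in> \<Omega>" "\<Omega> \<subseteq> \<Omega>'" "\<Omega>' \<subseteq> \<D>" shows "conf_rad \<Omega> \<le> conf_rad \<Omega>'"
proof (rule conf_rad_least[OF assms(1)])
  fix g assume "g holomorphic_on \<D>" "g 0 = 0" "g ` \<D> \<subseteq> \<Omega>"
  then show "norm (deriv g 0) \<le> conf_rad \<Omega>'"
    using assms(2) by (intro conf_rad_upper[OF assms(3)]) (assumption | rule subset_trans)+
qed

text \<open>Every competitor factors through \<open>f\<close> by subordination, and the Schwarz
  lemma bounds the derivative of the inner factor; \<open>f\<close> itself attains the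
  bound.\<close>

lemma conf_rad_univalent:
  assumes f: "f holomorphic_on \<D>" "inj_on f \<D>" "f 0 = 0" "f ` \<D> \<subseteq> \<D>"
  shows "conf_rad (f ` \<D>) = norm (deriv f 0)"
proof (rule antisym)
  show "conf_rad (f ` \<D>) \<le> norm (deriv f 0)"
  proof (rule conf_rad_least)
    show "0 \<in> f ` \<D>" using f(3) by (metis centre_in_ball imageI zero_less_one)
    fix g assume g: "g holomorphic_on \<D>" "g 0 = 0" "g ` \<D> \<subseteq> f ` \<D>"
    obtain \<phi> where "\<phi> holomorphic_on \<D>" "\<phi> 0 = 0" "\<phi> ` \<D> \<subseteq> \<D>" and d: "deriv g 0 = deriv f 0 * deriv \<phi> 0"
      using subordination[OF f(1-3) g] by metis
    then have "norm (deriv \<phi> 0) \<le> 1" by (intro norm_deriv_0_le_1)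
    then show "norm (deriv g 0) \<le> norm (deriv f 0)"
      unfolding d norm_mult by (rule mult_left_le) simp
  qed
qed (use f in \<open>auto intro: conf_rad_upper\<close>)

text \<open>A Riemann map is precomposed with a disc automorphism that makes it fix
  \<open>0\<close>, and then with a rotation that adjusts the argument of the derivative. The
  modulus is already the conformal radius.\<close>

lemma ex_univalent_onto:
  assumes "open \<Omega>" "simply_connected \<Omega>" "0 \<in> \<Omega>" "\<Omega> \<subseteq> \<D>" "norm c = conf_rad \<Omega>"
  obtains f where "f holomorphic_on \<D>" "inj_on f \<D>" "f 0 = 0" "f ` \<D> = \<Omega>" "deriv f 0 = c"
proof -
  have nU: "\<Omega> \<noteq> UNIV"
  proof
    assume "\<Omega> = UNIV"
    then have "(1::complex) \<in> \<D>" using assms(4) by blast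
    then show False by simp
  qed
  obtain f g where fg: "f holomorphic_on \<Omega>" "g holomorphic_on \<D>"
      "\<And>z. z \<in> \<Omega> \<Longrightarrow> f z \<in> \<D> \<and> g (f z) = z" "\<And>z. z \<in> \<D> \<Longrightarrow> g z \<in> \<Omega> \<and> f (g z) = z"
    using Riemann_mapping_theorem[of \<Omega>] assms(1-3) nU by blast
  have "f 0 \<in> \<D>" using fg(3) assms(3) by blast
  then obtain p q where pq: "p (f 0) = 0" "p holomorphic_on \<D>" "p ` \<D> \<subseteq> \<D>" "q holomorphic_on \<D>" "q ` \<D> \<subseteq> \<D>"
      "\<And>z. z \<in> \<D> \<Longrightarrow> p (q z) = z" "\<And>z. z \<in> \<D> \<Longrightarrow> q (p z) = z"
    using ball_biholomorphism_exists by metis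
  define h where "h = g \<circ> q"
  have h: "h holomorphic_on \<D>" unfolding h_def by (rule holomorphic_on_compose_gen[OF pq(4) fg(2) pq(5)])
  have q0: "q 0 = f 0" using pq(1) pq(7)[OF \<open>f 0 \<in> \<D>\<close>] by simp
  have h0: "h 0 = 0" using fg(3)[OF assms(3)] by (simp add: h_def q0)
  have "inj_on h \<D>"
  proof (rule inj_on_inverseI[where g = "p \<circ> f"])
    fix z assume "z \<in> \<D>"
    then have "q z \<in> \<D>" using pq(5) by blast
    then show "(p \<circ> f) (h z) = z" using fg(4) pq(6)[OF \<open>z \<in> \<D>\<close>] by (simp add: h_def)
  qed
  have him: "h ` \<D> = \<Omega>"
  proof
    show "h ` \<D> \<subseteq> \<Omega>" using pq(5) fg(4) unfolding h_def by (auto simp: image_subset_iff)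
    show "\<Omega> \<subseteq> h ` \<D>"
    proof
      fix w assume "w \<in> \<Omega>"
      then have "f w \<in> \<D>" "g (f w) = w" using fg(3) by auto
      then have "p (f w) \<in> \<D>" "h (p (f w)) = w" using pq by (auto simp: h_def image_subset_iff)
      then show "w \<in> h ` \<D>" by (metis imageI)
    qed
  qed
  have d0: "deriv h 0 \<noteq> 0"
    using holomorphic_injective_imp_regular[OF h open_ball \<open>inj_on h \<D>\<close>] by simp
  have nd: "norm (deriv h 0) = norm c"
    using conf_rad_univalent[OF h \<open>inj_on h \<D>\<close> h0] him assms by simp
  define u where "u = c / deriv h 0"
  have u: "norm u = 1" unfolding u_def norm_divide nd[symmetric] using d0 by simp
  have u0: "u \<noteq> 0" using u by auto
  let ?r = "\<lambda>z. u * z"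
  have rD: "?r ` \<D> = \<D>"
  proof
    show "?r ` \<D> \<subseteq> \<D>" using u by (auto simp: norm_mult)
    show "\<D> \<subseteq> ?r ` \<D>"
    proof
      fix z assume "z \<in> \<D>"
      then have "z / u \<in> \<D>" "z = ?r (z / u)" using u u0 by (auto simp: norm_divide)
      then show "z \<in> ?r ` \<D>" by (rule rev_image_eqI)
    qed
  qed
  have rh: "?r holomorphic_on \<D>" by (intro holomorphic_intros)
  show ?thesis
  proof (rule that[of "h \<circ> ?r"])
    show "h \<circ> ?r holomorphic_on \<D>" using rD by (intro holomorphic_on_compose_gen[OF rh h]) simp
    show "inj_on (h \<circ> ?r) \<D>"
      using \<open>inj_on h \<D>\<close> u0 by (intro comp_inj_on) (auto simp: rD inj_on_def)
    show "(h \<circ> ?r) 0 = 0" using h0 by simp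
    show "(h \<circ> ?r) ` \<D> = \<Omega>" using rD him by (simp only: image_comp[symmetric])
    have "deriv (h \<circ> ?r) 0 = deriv h 0 * deriv ?r 0"
      by (rule deriv_compose_disc[OF h rh]) auto
    also have "\<dots> = deriv h 0 * u" by simp
    also have "\<dots> = c" using d0 by (simp add: u_def)
    finally show "deriv (h \<circ> ?r) 0 = c" .
  qed
qed

section \<open>Discs slit along a path that starts on the unit circle\<close>

locale boundary_path =
  fixes \<gamma> :: "real \<Rightarrow> complex"
  assumes cont: "continuous_on {0..1} \<gamma>"
    and start: "\<gamma> 0 \<in> \<T>"
    and nz: "t \<in> {0..1} \<Longrightarrow> \<gamma> t \<noteq> 0"
begin

text \<open>Including the exterior of the disc makes the obstacle connected, since the path starts
  on the unit circle. Connectedness of the obstacle is what makes the domains \<open>cdom t\<close>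
  simply connected.\<close>

definition obst :: "real \<Rightarrow> complex set"
  where "obst t = - \<D> \<union> \<gamma> ` {0..t}"

definition cdom :: "real \<Rightarrow> complex set"
  where "cdom t = connected_component_set (- obst t) 0"

lemma obst_closed: assumes "t \<in> {0..1}" shows "closed (obst t)"
proof -
  have "compact (\<gamma> ` {0..t})"
    using assms by (intro compact_continuous_image continuous_on_subset[OF cont]) auto
  then show ?thesis
    unfolding obst_def by (intro closed_Un[OF closed_Compl[OF open_ball]] compact_imp_closed)
qed

lemma obst_connected: assumes "t \<in> {0..1}" shows "connected (obst t)"
  unfolding obst_def
proof (rule connected_Un)
  show "connected (- \<D>)" by (intro connected_complement_bounded_convex) auto
  show "connected (\<gamma> ` {0..t})"
    using assms by (intro connected_continuous_image continuous_on_subset[OF cont]) auto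
  have "\<gamma> 0 \<in> - \<D> \<inter> \<gamma> ` {0..t}" using start assms by auto
  then show "- \<D> \<inter> \<gamma> ` {0..t} \<noteq> {}" by blast
qed

lemma zero_notin_obst: "t \<in> {0..1} \<Longrightarrow> 0 \<in> - obst t"
  using nz by (force simp: obst_def)

lemma obst_mono: "s \<le> t \<Longrightarrow> obst s \<subseteq> obst t"
  by (auto simp: obst_def)

lemma cdom_open: "t \<in> {0..1} \<Longrightarrow> open (cdom t)"
  unfolding cdom_def using obst_closed by (intro open_connected_component) auto

lemma cdom_connected: "connected (cdom t)"
  unfolding cdom_def by (rule connected_connected_component)

lemma zero_in_cdom: "t \<in> {0..1} \<Longrightarrow> 0 \<in> cdom t"
  using zero_notin_obst by (simp add: cdom_def connected_component_refl)

lemma cdom_subset: "cdom t \<subseteq> - obst t"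
  unfolding cdom_def by (rule connected_component_subset)

lemma cdom_subset_disc: "cdom t \<subseteq> \<D>"
  using cdom_subset[of t] by (auto simp: obst_def)

lemma cdom_maximal: "connected S \<Longrightarrow> 0 \<in> S \<Longrightarrow> S \<inter> obst t = {} \<Longrightarrow> S \<subseteq> cdom t"
  unfolding cdom_def by (intro connected_component_maximal) auto

lemma cdom_antimono: "s \<le> t \<Longrightarrow> cdom t \<subseteq> cdom s"
  unfolding cdom_def using obst_mono by (intro connected_component_mono) auto

text \<open>A component of the complement of a connected set has connected complement, and for
  bounded connected open sets in the plane this means simple connectivity.\<close>

lemma cdom_simply_connected:
  assumes t: "t \<in> {0..1}" shows "simply_connected (cdom t)"
proof -
  have "cdom t \<in> components (- obst t)"
    using zero_notin_obst[OF t] unfolding cdom_def by (rule componentsI)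
  then have "connected (- cdom t)" by (rule component_complement_connected[OF obst_connected[OF t]])
  moreover have "bounded (cdom t)" by (rule bounded_subset[OF bounded_ball cdom_subset_disc])
  ultimately show ?thesis
    using simply_connected_iff_simple[OF cdom_open[OF t]] cdom_connected by simp
qed

definition rad :: "real \<Rightarrow> real"
  where "rad t = conf_rad (cdom t)"

lemma rad_antimono: "s \<le> t \<Longrightarrow> t \<in> {0..1} \<Longrightarrow> rad t \<le> rad s"
  unfolding rad_def by (rule conf_rad_mono[OF zero_in_cdom cdom_antimono cdom_subset_disc])

text \<open>Continuity from the right. For a competitor \<open>g\<close> at time \<open>t\<close>,
  the compact set \<open>g\<close> followed by \<open>cball 0 r\<close> stays away from
  \<open>\<gamma> t\<close>, so the path avoids it for a short while longer. Hence the dilate of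
  \<open>g\<close> by \<open>r\<close> is a competitor at some \<open>s > t\<close>, and
  \<open>r\<close> may tend to \<open>1\<close>.\<close>

lemma rad_le_right:
  assumes t: "t \<in> {0..<1}" and le: "\<And>s. s \<in> {t<..1} \<Longrightarrow> rad s \<le> v"
  shows "rad t \<le> v"
  unfolding rad_def
proof (rule conf_rad_least)
  show "0 \<in> cdom t" using t by (intro zero_in_cdom) auto
  fix g assume g: "g holomorphic_on \<D>" "g 0 = 0" "g ` \<D> \<subseteq> cdom t"
  show "norm (deriv g 0) \<le> v"
  proof (rule field_le_mult_one_interval)
    fix r :: real assume r: "0 < r" "r < 1"
    let ?S = "g ` cball 0 r"
    have sub: "cball 0 r \<subseteq> \<D>" using r by auto
    have "compact ?S"
      by (intro compact_continuous_image holomorphic_on_imp_continuous_on holomorphic_on_subset[OF g(1) sub]) auto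
    then have cl: "open (- ?S)" by (simp add: compact_imp_closed open_Compl)
    have disj: "?S \<inter> obst t = {}" using g(3) image_mono[OF sub, of g] cdom_subset[of t] by blast
    moreover have "\<gamma> t \<in> obst t" using t by (simp add: obst_def)
    ultimately have "\<gamma> t \<in> - ?S" by (metis ComplI IntI empty_iff)
    then obtain e where e: "e > 0" "ball (\<gamma> t) e \<subseteq> - ?S" using cl open_contains_ball by blast
    obtain d where d: "d > 0" "\<And>u. u \<in> {0..1} \<Longrightarrow> dist u t < d \<Longrightarrow> dist (\<gamma> u) (\<gamma> t) < e"
    proof -
      have "t \<in> {0..1}" using t by auto
      from cont[unfolded continuous_on_iff, rule_format, OF this e(1)]
      obtain d where "d > 0" "\<forall>u\<in>{0..1}. dist u t < d \<longrightarrow> dist (\<gamma> u) (\<gamma> t) < e" by (elim exE conjE)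
      then show ?thesis by (intro that[of d]) simp_all
    qed
    define s where "s = min 1 (t + d / 2)"
    have s: "s \<in> {t<..1}" using t d by (auto simp: s_def)
    have avoid: "\<gamma> u \<notin> ?S" if "u \<in> {t..s}" for u
    proof -
      have "dist u t < d" using that d by (auto simp: s_def dist_real_def)
      then have "dist (\<gamma> u) (\<gamma> t) < e" using d(2)[of u] that s t by auto
      then show ?thesis using e(2) by (auto simp: dist_commute subset_iff)
    qed
    have "\<gamma> ` {0..s} \<subseteq> \<gamma> ` {0..t} \<union> \<gamma> ` {t..s}"
      unfolding image_Un[symmetric] by (rule image_mono) auto
    then have obst_s: "obst s \<subseteq> obst t \<union> \<gamma> ` {t..s}" unfolding obst_def by auto
    have disj': "?S \<inter> obst s = {}"
    proof (intro disjoint_iff[THEN iffD2] allI impI notI)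
      fix x assume x: "x \<in> ?S" "x \<in> obst s"
      then consider "x \<in> obst t" | "x \<in> \<gamma> ` {t..s}" using obst_s by (meson UnE subsetD)
      then show False
      proof cases
        case 1
        with x(1) have "x \<in> ?S \<inter> obst t" by (rule IntI)
        then show ?thesis unfolding disj by simp
      next
        case 2
        then obtain u where "u \<in> {t..s}" "x = \<gamma> u" by (elim imageE) simp
        then show ?thesis using avoid x(1) by simp
      qed
    qed
    let ?h = "g \<circ> (\<lambda>z. of_real r * z)"
    have im: "(\<lambda>z. of_real r * z) ` \<D> \<subseteq> \<D>" "(\<lambda>z. of_real r * z) ` \<D> \<subseteq> cball 0 r"
    proof -
      show 2: "(\<lambda>z. of_real r * z) ` \<D> \<subseteq> cball 0 r"
      proof (rule image_subsetI)
        fix z :: complex assume "z \<in> \<D>"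
        then have "r * norm z \<le> r * 1" using r by (intro mult_left_mono) auto
        then show "of_real r * z \<in> cball 0 r" using r by (simp add: norm_mult)
      qed
      then show "(\<lambda>z. of_real r * z) ` \<D> \<subseteq> \<D>" using sub by blast
    qed
    have rh: "(\<lambda>z. of_real r * z) holomorphic_on \<D>" by (intro holomorphic_intros)
    have h: "?h holomorphic_on \<D>" by (rule holomorphic_on_compose_gen[OF rh g(1) im(1)])
    have "?h ` \<D> \<subseteq> cdom s"
    proof (rule cdom_maximal)
      show "connected (?h ` \<D>)" by (intro connected_continuous_image holomorphic_on_imp_continuous_on h) auto
      show "0 \<in> ?h ` \<D>" using g(2) by (intro image_eqI[of _ _ 0]) auto
      have "?h ` \<D> \<subseteq> ?S" using im(2) by auto
      then show "?h ` \<D> \<inter> obst s = {}" using disj' by blast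
    qed
    then have "norm (deriv ?h 0) \<le> rad s"
      unfolding rad_def using h g(2) by (intro conf_rad_upper cdom_subset_disc) auto
    moreover have "deriv ?h 0 = deriv g 0 * deriv (\<lambda>z. of_real r * z) 0"
      by (rule deriv_compose_disc[OF g(1) rh]) auto
    ultimately have "r * norm (deriv g 0) \<le> rad s" using r by (simp add: norm_mult mult.commute)
    then show "r * norm (deriv g 0) \<le> v" using le[OF s] by simp
  qed
qed

text \<open>Continuity from the left. Normalized Riemann maps onto the domains
  \<open>cdom (s n)\<close> form a normal family. A limit \<open>g\<close> has derivative of modulus
  at least \<open>v > 0\<close> at \<open>0\<close>, so it is nonconstant; its image avoids
  \<open>obst t\<close>, which makes it a competitor for \<open>cdom t\<close>.\<close>

lemma rad_ge_left:
  assumes t: "t \<in> {0<..1}" and s: "\<And>n. s n \<in> {0..t}" "s \<longlonglongrightarrow> t"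
    and ge: "\<And>n. v \<le> rad (s n)" and "0 < v"
  shows "v \<le> rad t"
proof -
  have s01: "s n \<in> {0..1}" for n using s(1)[of n] t by auto
  \<comment> \<open>Prescribing a positive derivative removes the rotational freedom, so the
    derivatives themselves are the conformal radii.\<close>
  have "\<exists>f. f holomorphic_on \<D> \<and> f 0 = 0 \<and> f ` \<D> = cdom (s n) \<and> deriv f 0 = of_real (rad (s n))" for n
    by (rule ex_univalent_onto[of "cdom (s n)" "of_real (rad (s n))"])
      (use cdom_open[OF s01] cdom_simply_connected[OF s01] zero_in_cdom[OF s01] cdom_subset_disc ge[of n] \<open>0 < v\<close>
        in \<open>auto simp: rad_def\<close>)
  then obtain F where F: "\<And>n. F n holomorphic_on \<D>" "\<And>n. F n 0 = 0" "\<And>n. F n ` \<D> = cdom (s n)"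
      "\<And>n. deriv (F n) 0 = of_real (rad (s n))"
    by metis
  let ?H = "{h. h holomorphic_on \<D> \<and> h ` \<D> \<subseteq> \<D>}"
  obtain g q where g: "g holomorphic_on \<D>" and q: "strict_mono (q :: nat \<Rightarrow> nat)"
      and pw: "\<And>x. x \<in> \<D> \<Longrightarrow> (\<lambda>n. F (q n) x) \<longlonglongrightarrow> g x"
      and ul: "\<And>K. compact K \<Longrightarrow> K \<subseteq> \<D> \<Longrightarrow> uniform_limit K (F \<circ> q) g sequentially"
  proof (rule Montel[of \<D> ?H F])
    show "\<exists>B. \<forall>h\<in>?H. \<forall>z\<in>K. norm (h z) \<le> B" if "compact K" "K \<subseteq> \<D>" for K
      using that by (intro exI[of _ 1]) (auto simp: image_subset_iff subset_iff intro: less_imp_le)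
    show "range F \<subseteq> ?H" using F(1,3) cdom_subset_disc by blast
  qed auto
  have "(\<lambda>n. 0) \<longlonglongrightarrow> g 0" using pw[of 0] F(2) by simp
  then have g0: "g 0 = 0" by (rule LIMSEQ_unique) (rule tendsto_const)
  have "(\<lambda>n. (deriv ^^ 1) ((F \<circ> q) n) 0) \<longlonglongrightarrow> (deriv ^^ 1) g 0"
  proof (rule higher_deriv_complex_uniform_limit[where A = "ball 0 (1/2)"])
    have "uniform_limit (cball 0 (1/2)) (F \<circ> q) g sequentially" by (rule ul) auto
    then show "uniform_limit (ball 0 (1/2)) (F \<circ> q) g sequentially"
      by (rule uniform_limit_on_subset) auto
    show "\<forall>\<^sub>F n in sequentially. (F \<circ> q) n holomorphic_on ball 0 (1/2)"
      by (intro always_eventually allI) (auto intro!: holomorphic_on_subset[OF F(1)])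
  qed auto
  then have "(\<lambda>n. complex_of_real (rad (s (q n)))) \<longlonglongrightarrow> deriv g 0" by (simp add: F(4))
  from tendsto_norm[OF this] have dg: "v \<le> norm (deriv g 0)"
    by (rule Lim_bounded2) (auto intro!: order_trans[OF ge abs_ge_self])
  have nc: "\<not> g constant_on \<D>"
  proof
    assume "g constant_on \<D>"
    then obtain c where "\<And>z. z \<in> \<D> \<Longrightarrow> g z = c" by (auto simp: constant_on_def)
    then have "deriv g 0 = deriv (\<lambda>_. c) 0"
      by (intro complex_derivative_transform_within_open[OF g _ open_ball]) auto
    then have "deriv g 0 = 0" by simp
    then show False using dg \<open>0 < v\<close> by simp
  qed
  \<comment> \<open>By Hurwitz' theorem a value omitted by all late maps is omitted by the
    nonconstant limit.\<close>
  have omit: "w \<notin> g ` \<D>" if ev: "\<forall>\<^sub>F n in sequentially. w \<in> obst (s (q n))" for w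
  proof
    assume "w \<in> g ` \<D>"
    then obtain z0 where z0: "z0 \<in> \<D>" "g z0 = w" by blast
    obtain N where N: "\<And>n. n \<ge> N \<Longrightarrow> w \<in> obst (s (q n))" using ev by (auto simp: eventually_sequentially)
    have "g z0 - w \<noteq> 0"
    proof (rule Hurwitz_no_zeros[of \<D> "\<lambda>n z. F (q (n + N)) z - w" "\<lambda>z. g z - w" z0])
      show "(\<lambda>z. F (q (n + N)) z - w) holomorphic_on \<D>" for n by (intro holomorphic_intros F(1))
      show "(\<lambda>z. g z - w) holomorphic_on \<D>" by (intro holomorphic_intros g)
      show "uniform_limit K (\<lambda>n z. F (q (n + N)) z - w) (\<lambda>z. g z - w) sequentially"
        if "compact K" "K \<subseteq> \<D>" for K
      proof -
        have "filterlim (\<lambda>n. n + N) sequentially sequentially" by (rule filterlim_add_const_nat_at_top)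
        from filterlim_compose[OF ul[OF that] this]
        show ?thesis by (intro uniform_limit_intros) (simp add: o_def)
      qed
      show "\<not> (\<lambda>z. g z - w) constant_on \<D>"
      proof
        assume "(\<lambda>z. g z - w) constant_on \<D>"
        then obtain c where "\<And>z. z \<in> \<D> \<Longrightarrow> g z - w = c" by (auto simp: constant_on_def)
        then have "\<And>z. z \<in> \<D> \<Longrightarrow> g z = c + w" by (metis diff_add_cancel)
        then show False using nc by (auto simp: constant_on_def)
      qed
      show "F (q (n + N)) z - w \<noteq> 0" if "z \<in> \<D>" for n z
        using N[of "n + N"] F(3)[of "q (n + N)"] cdom_subset that by fastforce
    qed (use z0 in auto)
    then show False using z0 by simp
  qed
  have omit_before: "\<gamma> u \<notin> g ` \<D>" if u: "u \<in> {0..<t}" for u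
  proof (rule omit)
    have "(\<lambda>n. s (q n)) \<longlonglongrightarrow> t" using LIMSEQ_subseq_LIMSEQ[OF s(2) q] by (simp add: o_def)
    then have "\<forall>\<^sub>F n in sequentially. u < s (q n)" using u by (intro order_tendstoD(1)) auto
    then show "\<forall>\<^sub>F n in sequentially. \<gamma> u \<in> obst (s (q n))"
      by eventually_elim (use u in \<open>auto simp: obst_def\<close>)
  qed
  \<comment> \<open>The point \<open>\<gamma> t\<close> may be missing from every
    \<open>obst (s n)\<close>, so the previous argument does not reach it. But an open image
    containing it would also contain path points from slightly earlier times.\<close>
  have omit_t: "\<gamma> t \<notin> g ` \<D>"
  proof
    assume "\<gamma> t \<in> g ` \<D>"
    moreover have "open (g ` \<D>)" by (rule open_mapping_thm[OF g _ _ _ _ nc]) auto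
    ultimately obtain e where e: "e > 0" "ball (\<gamma> t) e \<subseteq> g ` \<D>" using open_contains_ball by blast
    obtain d where d: "d > 0" "\<And>u. u \<in> {0..1} \<Longrightarrow> dist u t < d \<Longrightarrow> dist (\<gamma> u) (\<gamma> t) < e"
    proof -
      have "t \<in> {0..1}" using t by auto
      from cont[unfolded continuous_on_iff, rule_format, OF this e(1)]
      obtain d where "d > 0" "\<forall>u\<in>{0..1}. dist u t < d \<longrightarrow> dist (\<gamma> u) (\<gamma> t) < e" by (elim exE conjE)
      then show ?thesis by (intro that[of d]) simp_all
    qed
    define u where "u = max 0 (t - d / 2)"
    have u: "u \<in> {0..<t}" "dist u t < d" using t d by (auto simp: u_def dist_real_def)
    then have "\<gamma> u \<in> g ` \<D>" using d(2)[of u] t e(2) by (auto simp: dist_commute subset_iff)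
    then show False using omit_before[OF u(1)] by blast
  qed
  have "g ` \<D> \<inter> obst t = {}"
  proof -
    have "w \<notin> g ` \<D>" if w: "w \<in> obst t" for w
    proof (cases "w \<in> - \<D>")
      case True
      then show ?thesis by (intro omit) (simp add: obst_def)
    next
      case False
      then obtain u where "w = \<gamma> u" "u \<in> {0..t}" using w by (auto simp: obst_def)
      then show ?thesis using omit_before[of u] omit_t by (cases "u = t") auto
    qed
    then show ?thesis by blast
  qed
  then have "g ` \<D> \<subseteq> cdom t"
    using g g0 by (intro cdom_maximal connected_continuous_image holomorphic_on_imp_continuous_on)
      (auto intro!: image_eqI[of _ _ 0])
  then have "norm (deriv g 0) \<le> rad t"
    unfolding rad_def by (intro conf_rad_upper cdom_subset_disc g g0)
  then show ?thesis using dg by simp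
qed

text \<open>At the supremum of the times with \<open>rad \<ge> v\<close>, continuity from the left
  gives \<open>rad \<ge> v\<close> and continuity from the right gives
  \<open>rad \<le> v\<close>.\<close>

lemma rad_IVT:
  assumes v: "rad 1 \<le> v" "v \<le> rad 0" "0 < v"
  obtains t where "t \<in> {0..1}" "rad t = v"
proof -
  define A where "A = {t \<in> {0..1}. v \<le> rad t}"
  define t where "t = Sup A"
  have "0 \<in> A" using v by (simp add: A_def)
  moreover have "bdd_above A" by (rule bdd_aboveI[of _ 1]) (simp add: A_def)
  ultimately have A: "A \<noteq> {}" "bdd_above A" "0 \<in> A" by auto
  have up: "a \<le> t" if "a \<in> A" for a unfolding t_def using that A by (intro cSup_upper)
  have "t \<le> 1" unfolding t_def using A by (intro cSup_least) (auto simp: A_def)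
  then have t: "t \<in> {0..1}" using up[OF A(3)] by simp
  have "rad t \<ge> v"
  proof (cases "t = 0")
    case False
    obtain s where s: "\<And>n. s n \<in> A" "s \<longlonglongrightarrow> t"
      using closure_contains_Sup[OF A(1,2)] unfolding t_def[symmetric] closure_sequential by blast
    show ?thesis
    proof (rule rad_ge_left[of t s])
      show "s n \<in> {0..t}" for n using s(1)[of n] up[OF s(1)] by (auto simp: A_def)
    qed (use False t s v in \<open>auto simp: A_def\<close>)
  qed (use v in simp)
  moreover have "rad t \<le> v"
  proof (cases "t = 1")
    case False
    show ?thesis
    proof (rule rad_le_right)
      show "rad s \<le> v" if "s \<in> {t<..1}" for s
        using up[of s] that t by (force simp: A_def)
    qed (use False t in auto)
  qed (use v in simp)
  ultimately show ?thesis using that t by force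
qed

section \<open>Chains of univalent maps along the path\<close>

lemma cdom_0: "cdom 0 = \<D>"
proof
  have "\<gamma> 0 \<in> - \<D>" using start by auto
  then have "obst 0 = - \<D>" by (auto simp: obst_def)
  then show "\<D> \<subseteq> cdom 0" by (intro cdom_maximal) auto
qed (rule cdom_subset_disc)

lemma rad_0: "rad 0 = 1"
proof -
  have "conf_rad ((\<lambda>z. z) ` \<D>) = norm (deriv (\<lambda>z::complex. z) 0)"
    by (rule conf_rad_univalent) (auto simp: inj_on_def)
  then show ?thesis by (simp add: rad_def cdom_0)
qed

text \<open>A logarithm \<open>L\<close> of the derivative allows modulus and argument to be divided
  evenly. The modulus selects a time through the intermediate value property, and the argument is
  realized by rotating the Riemann map.\<close>

lemma univalent_chain:
  assumes f: "f holomorphic_on \<D>" "inj_on f \<D>" "f 0 = 0" "f ` \<D> = cdom 1"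
    and L: "deriv f 0 = exp L" "Re L < 0" and n: "n > 0"
  obtains G :: "nat \<Rightarrow> complex \<Rightarrow> complex" where "\<And>z. G 0 z = z" "G n = f"
    "\<And>j. j \<le> n \<Longrightarrow> G j holomorphic_on \<D> \<and> inj_on (G j) \<D> \<and> G j 0 = 0 \<and> deriv (G j) 0 = exp (of_nat j * L / of_nat n)"
    "\<And>j. j < n \<Longrightarrow> G (Suc j) ` \<D> \<subseteq> G j ` \<D>"
proof -
  define v where "v j = exp (real j * Re L / real n)" for j
  have rad1: "rad 1 = exp (Re L)"
    using conf_rad_univalent[OF f(1-3)] cdom_subset_disc[of 1] by (simp add: rad_def f(4) L)
  have v_less: "v (Suc j) < v j" for j
    using L(2) n by (simp add: v_def divide_strict_right_mono)
  \<comment> \<open>The two extreme times are prescribed so that the extreme domains are the disc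
    and the image of \<open>f\<close>, which lets the identity and \<open>f\<close> itself serve as
    extreme maps.\<close>
  have "\<exists>t. t \<in> {0..1} \<and> rad t = v j \<and> (j = 0 \<longrightarrow> t = 0) \<and> (j = n \<longrightarrow> t = 1)" if j: "j \<le> n" for j
  proof -
    consider "j = 0" | "j = n" | "0 < j" "j < n" using j by linarith
    then show ?thesis
    proof cases
      case 3
      have "rad 1 \<le> v j"
      proof -
        have "Re L = real n * Re L / real n" using n by simp
        also have "\<dots> \<le> real j * Re L / real n"
          using j L(2) n by (intro divide_right_mono mult_right_mono_neg) auto
        finally show ?thesis by (simp add: rad1 v_def)
      qed
      moreover have "v j \<le> rad 0"
        using L(2) by (simp add: rad_0 v_def divide_nonpos_nonneg mult_nonneg_nonpos)
      ultimately obtain t where "t \<in> {0..1}" "rad t = v j" using rad_IVT[of "v j"] by (auto simp: v_def)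
      then show ?thesis using 3 by auto
    qed (use n rad_0 rad1 in \<open>auto simp: v_def\<close>)
  qed
  then obtain \<tau> where \<tau>: "\<And>j. j \<le> n \<Longrightarrow> \<tau> j \<in> {0..1}" "\<And>j. j \<le> n \<Longrightarrow> rad (\<tau> j) = v j" "\<tau> 0 = 0" "\<tau> n = 1"
    by (metis le_refl zero_le)
  have "\<exists>g. g holomorphic_on \<D> \<and> inj_on g \<D> \<and> g 0 = 0 \<and> g ` \<D> = cdom (\<tau> j)
      \<and> deriv g 0 = exp (of_nat j * L / of_nat n) \<and> (j = 0 \<longrightarrow> g = (\<lambda>z. z)) \<and> (j = n \<longrightarrow> g = f)" if j: "j \<le> n" for j
  proof -
    consider "j = 0" | "j = n" | "0 < j" "j < n" using j by linarith
    then show ?thesis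
    proof cases
      case 1
      then show ?thesis using n by (auto simp: \<tau> cdom_0 inj_on_def intro!: exI[of _ "\<lambda>z. z"])
    next
      case 2
      then show ?thesis using n f by (auto simp: \<tau> L intro!: exI[of _ f])
    next
      case 3
      have "norm (exp (of_nat j * L / of_nat n)) = conf_rad (cdom (\<tau> j))"
        using \<tau>(2)[OF j] by (simp add: rad_def v_def)
      then show ?thesis
        using ex_univalent_onto[OF cdom_open[OF \<tau>(1)] cdom_simply_connected[OF \<tau>(1)] zero_in_cdom[OF \<tau>(1)] cdom_subset_disc, OF j j j]
          3 by (metis less_irrefl)
    qed
  qed
  then obtain G where G: "\<And>j. j \<le> n \<Longrightarrow> G j holomorphic_on \<D> \<and> inj_on (G j) \<D> \<and> G j 0 = 0 \<and> G j ` \<D> = cdom (\<tau> j)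
      \<and> deriv (G j) 0 = exp (of_nat j * L / of_nat n) \<and> (j = 0 \<longrightarrow> G j = (\<lambda>z. z)) \<and> (j = n \<longrightarrow> G j = f)"
    by metis
  show ?thesis
  proof (rule that[of G])
    show "G (Suc j) ` \<D> \<subseteq> G j ` \<D>" if j: "j < n" for j
    proof -
      \<comment> \<open>Since \<open>rad\<close> is antitone, the strict decrease of
        \<open>v\<close> puts the chosen times in order.\<close>
      have "\<tau> j \<le> \<tau> (Suc j)"
      proof (rule ccontr)
        assume "\<not> \<tau> j \<le> \<tau> (Suc j)"
        then have "rad (\<tau> j) \<le> rad (\<tau> (Suc j))" using \<tau>(1) j by (intro rad_antimono) auto
        then show False using \<tau>(2) j v_less[of j] by simp
      qed
      then show ?thesis using G[of j] G[of "Suc j"] j cdom_antimono by simp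
    qed
    show "G 0 z = z" for z using G[of 0] by simp
    show "G n = f" using G[of n] by simp
    show "G j holomorphic_on \<D> \<and> inj_on (G j) \<D> \<and> G j 0 = 0 \<and> deriv (G j) 0 = exp (of_nat j * L / of_nat n)"
      if "j \<le> n" for j
      using G[OF that] by simp
  qed
qed

end

text \<open>The radial segment misses the image because its points other than \<open>p\<close> have
  modulus above the maximum \<open>norm p\<close>, and \<open>p\<close> itself is a boundary value.
  The component of \<open>0\<close> cannot grow past the image because the frontier of the image
  lies on the path.\<close>

lemma ex_boundary_path:
  assumes f: "f holomorphic_on ball 0 \<rho>" "inj_on f (ball 0 \<rho>)" "1 < \<rho>" "f 0 = 0" "f ` cball 0 1 \<subseteq> \<D>"
  obtains \<gamma> where "boundary_path \<gamma>" "boundary_path.cdom \<gamma> 1 = f ` \<D>"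
proof -
  have sub: "cball 0 1 \<subseteq> ball 0 \<rho>" "\<D> \<subseteq> ball 0 \<rho>" using f(3) by auto
  have fD: "f holomorphic_on \<D>" "inj_on f \<D>" using f(1,2) sub holomorphic_on_subset inj_on_subset by blast+
  have fc: "continuous_on (cball 0 1) f"
    using f(1) sub holomorphic_on_subset holomorphic_on_imp_continuous_on by blast
  have ncst: "\<not> f constant_on \<D>"
  proof
    assume "f constant_on \<D>"
    then have "f 0 = f (1/2)" by (auto simp: constant_on_def)
    then show False using inj_onD[OF fD(2), of 0 "1/2"] by simp
  qed
  have opn: "open (f ` \<D>)" by (rule open_mapping_thm[OF fD(1) _ _ _ _ ncst]) auto
  obtain z0 where z0: "z0 \<in> cball 0 1" "\<And>z. z \<in> cball 0 1 \<Longrightarrow> norm (f z) \<le> norm (f z0)"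
  proof -
    have "\<exists>x\<in>cball 0 1. \<forall>y\<in>cball 0 1. norm (f y) \<le> norm (f x)"
      by (rule continuous_attains_sup) (use fc in \<open>auto intro!: continuous_intros\<close>)
    then show ?thesis using that by blast
  qed
  have "z0 \<notin> \<D>"
  proof
    assume "z0 \<in> \<D>"
    then have "f constant_on \<D>"
      using z0 by (intro maximum_modulus_principle[OF fD(1), of \<D> z0]) auto
    then show False using ncst by simp
  qed
  then have nz0: "norm z0 = 1" using z0 by auto
  define p where "p = f z0"
  have p_out: "f z0 \<notin> f ` \<D>"
  proof
    assume "f z0 \<in> f ` \<D>"
    then obtain y where "y \<in> \<D>" "f y = f z0" by auto
    moreover have "y \<in> ball 0 \<rho>" "z0 \<in> ball 0 \<rho>" using sub z0(1) \<open>y \<in> \<D>\<close> by blast+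
    ultimately have "y = z0" using f(2) by (auto dest: inj_onD)
    then show False using \<open>y \<in> \<D>\<close> \<open>z0 \<notin> \<D>\<close> by simp
  qed
  have circ_out: "f ` \<T> \<inter> f ` \<D> = {}"
  proof -
    have "f ` \<T> \<inter> f ` \<D> = f ` (\<T> \<inter> \<D>)"
      using f(2) sub by (intro inj_on_image_Int[symmetric, of f "ball 0 \<rho>"]) (use f(3) in auto)
    then show ?thesis by auto
  qed
  have zero_in: "0 \<in> f ` \<D>" using f(4) by (intro image_eqI[of _ _ 0]) auto
  have p0: "p \<noteq> 0" using p_out zero_in by (auto simp: p_def)
  have "f z0 \<in> \<D>" using f(5) z0(1) by blast
  then have p1: "norm p < 1" by (simp add: p_def)
  \<comment> \<open>The factor \<open>z0\<close> rotates the circle so that the loop begins at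
    \<open>f z0 = p\<close>, where the segment ends.\<close>
  define \<gamma> where "\<gamma> = linepath (sgn p) p +++ (\<lambda>t. f (z0 * circlepath 0 1 t))"
  have cz: "(\<lambda>t. z0 * circlepath 0 1 t) ` {0..1} = \<T>"
  proof -
    have "(\<lambda>t. z0 * circlepath 0 1 t) ` {0..1} = (*) z0 ` path_image (circlepath 0 1)"
      by (simp add: path_image_def image_image)
    also have "path_image (circlepath 0 1) = \<T>" by simp
    also have "(*) z0 ` \<T> = \<T>"
    proof
      show "(*) z0 ` \<T> \<subseteq> \<T>" using nz0 by (auto simp: norm_mult)
      show "\<T> \<subseteq> (*) z0 ` \<T>"
      proof
        fix w assume "w \<in> \<T>"
        then have "w / z0 \<in> \<T>" "w = z0 * (w / z0)" using nz0 by (auto simp: norm_divide)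
        then show "w \<in> (*) z0 ` \<T>" by (rule rev_image_eqI)
      qed
    qed
    finally show ?thesis .
  qed
  let ?c = "\<lambda>t. f (z0 * circlepath 0 1 t)"
  have pc: "path ?c"
    unfolding path_def
  proof (rule continuous_on_compose2[OF fc])
    show "continuous_on {0..1} (\<lambda>t. z0 * circlepath 0 1 t)"
      using path_circlepath[of 0 1] unfolding path_def by (intro continuous_intros)
    show "(\<lambda>t. z0 * circlepath 0 1 t) ` {0..1} \<subseteq> cball 0 1" unfolding cz by auto
  qed
  have ps: "pathstart ?c = p" by (simp add: pathstart_def circlepath p_def)
  have pg: "path \<gamma>" unfolding \<gamma>_def using pc ps by (intro path_join_imp) auto
  have pic: "path_image ?c = f ` \<T>"
    unfolding path_image_def using cz by (metis image_image)
  have pi: "path_image \<gamma> = closed_segment (sgn p) p \<union> f ` \<T>"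
    unfolding \<gamma>_def using ps pic by (subst path_image_join) auto
  have seg_out: "x \<notin> f ` \<D>" if "x \<in> closed_segment (sgn p) p" for x
  proof
    assume x: "x \<in> f ` \<D>"
    obtain u where u: "0 \<le> u" "u \<le> 1" "x = (1 - u) *\<^sub>R sgn p + u *\<^sub>R p"
      using \<open>x \<in> closed_segment (sgn p) p\<close> by (auto simp: in_segment)
    \<comment> \<open>Each point of the segment is \<open>c * p\<close> with
      \<open>c \<ge> 1\<close>. Lying in the image would bound its modulus by \<open>norm p\<close>,
      forcing \<open>c = 1\<close> and hence the point \<open>p\<close>.\<close>
    define c where "c = (1 - u) / norm p + u"
    have xc: "x = of_real c * p" using p0
      by (simp add: u(3) c_def sgn_div_norm scaleR_conv_of_real field_simps)
    have c1: "c - 1 = (1 - u) * (1 / norm p - 1)" using p0 by (simp add: c_def field_simps)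
    have ip: "1 / norm p - 1 > 0" using p0 p1 by simp
    then have "c \<ge> 1" using c1 u by (metis diff_ge_0_iff_ge less_imp_le mult_nonneg_nonneg)
    have "norm x \<le> norm p" using x z0(2) by (auto simp: p_def)
    then have "c * norm p \<le> 1 * norm p" using \<open>c \<ge> 1\<close> by (simp add: xc norm_mult)
    then have "c \<le> 1" using p0 by (metis mult_le_cancel_right_pos zero_less_norm_iff)
    then have "c = 1" using \<open>c \<ge> 1\<close> by simp
    then show False using x p_out xc by (simp add: p_def)
  qed
  have out: "path_image \<gamma> \<inter> f ` \<D> = {}" using pi seg_out circ_out by blast
  have bp: "boundary_path \<gamma>"
  proof
    show "continuous_on {0..1} \<gamma>" using pg by (simp add: path_def)
    have "pathstart \<gamma> = sgn p" by (simp add: \<gamma>_def)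
    then show "\<gamma> 0 \<in> \<T>" using p0 by (simp add: pathstart_def norm_sgn)
    show "\<gamma> t \<noteq> 0" if "t \<in> {0..1}" for t
    proof
      assume "\<gamma> t = 0"
      then have "0 \<in> path_image \<gamma>" using that unfolding path_image_def by (metis imageI)
      then show False using out zero_in by blast
    qed
  qed
  interpret boundary_path \<gamma> by (rule bp)
  have obst1: "obst 1 = - \<D> \<union> path_image \<gamma>" by (simp add: obst_def path_image_def)
  have "cdom 1 = f ` \<D>"
  proof
    show "f ` \<D> \<subseteq> cdom 1"
    proof (rule cdom_maximal)
      show "connected (f ` \<D>)"
        by (intro connected_continuous_image holomorphic_on_imp_continuous_on fD) auto
      show "f ` \<D> \<inter> obst 1 = {}" using out f(5) unfolding obst1 by (auto simp: image_subset_iff)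
    qed (rule zero_in)
    show "cdom 1 \<subseteq> f ` \<D>"
    proof (rule ccontr)
      assume "\<not> cdom 1 \<subseteq> f ` \<D>"
      then have "cdom 1 \<inter> frontier (f ` \<D>) \<noteq> {}"
        using zero_in zero_in_cdom[of 1] by (intro connected_Int_frontier cdom_connected) auto
      moreover have "frontier (f ` \<D>) \<subseteq> f ` \<T>"
      proof -
        have "closed (f ` cball 0 1)" by (intro compact_imp_closed compact_continuous_image fc) auto
        then have "closure (f ` \<D>) \<subseteq> f ` cball 0 1" by (intro closure_minimal) auto
        then have "frontier (f ` \<D>) \<subseteq> f ` cball 0 1 - f ` \<D>"
          using opn by (auto simp: frontier_def interior_open)
        moreover have "f ` cball 0 1 \<subseteq> f ` \<D> \<union> f ` \<T>"
          unfolding image_Un[symmetric] by (intro image_mono) auto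
        ultimately show ?thesis by blast
      qed
      ultimately show False using cdom_subset[of 1] pi unfolding obst1 by blast
    qed
  qed
  with bp show ?thesis by (rule that)
qed

text \<open>Consecutive maps of the chain are subordinate, and by the chain rule the equally spaced
  exponents give every factor the same derivative at \<open>0\<close>.\<close>

theorem univalent_factorization:
  assumes f: "f holomorphic_on ball 0 \<rho>" "inj_on f (ball 0 \<rho>)" "1 < \<rho>" "f 0 = 0" "f ` cball 0 1 \<subseteq> \<D>"
    and L: "deriv f 0 = exp L" "Re L < 0" and n: "n > 0"
  obtains G \<phi> :: "nat \<Rightarrow> complex \<Rightarrow> complex" where "\<And>z. G 0 z = z" "G n = f"
    "\<And>j. j < n \<Longrightarrow> \<phi> j holomorphic_on \<D> \<and> \<phi> j 0 = 0 \<and> \<phi> j ` \<D> \<subseteq> \<D> \<and> deriv (\<phi> j) 0 = exp (L / of_nat n)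
       \<and> (\<forall>z\<in>\<D>. G (Suc j) z = G j (\<phi> j z))"
proof -
  obtain \<gamma> where \<gamma>: "boundary_path \<gamma>" "boundary_path.cdom \<gamma> 1 = f ` \<D>"
    using ex_boundary_path[OF f] .
  interpret boundary_path \<gamma> by (rule \<gamma>(1))
  have sub: "\<D> \<subseteq> ball 0 \<rho>" using f(3) by auto
  have fD: "f holomorphic_on \<D>" "inj_on f \<D>" using f(1,2) sub holomorphic_on_subset inj_on_subset by blast+
  obtain G where G: "\<And>z. G 0 z = z" "G n = f"
    "\<And>j. j \<le> n \<Longrightarrow> G j holomorphic_on \<D> \<and> inj_on (G j) \<D> \<and> G j 0 = 0 \<and> deriv (G j) 0 = exp (of_nat j * L / of_nat n)"
    "\<And>j. j < n \<Longrightarrow> G (Suc j) ` \<D> \<subseteq> G j ` \<D>"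
    by (rule univalent_chain[OF fD f(4) \<gamma>(2)[symmetric] L n]) (rule that; assumption)
  define P where "P j \<phi> \<longleftrightarrow> \<phi> holomorphic_on \<D> \<and> \<phi> 0 = 0 \<and> \<phi> ` \<D> \<subseteq> \<D> \<and> deriv \<phi> 0 = exp (L / of_nat n)
      \<and> (\<forall>z\<in>\<D>. G (Suc j) z = G j (\<phi> z))" for j \<phi>
  have "\<exists>\<phi>. P j \<phi>" if j: "j < n" for j
  proof -
    have Gj: "G j holomorphic_on \<D>" "inj_on (G j) \<D>" "G j 0 = 0" using G(3)[of j] j by auto
    have Gsj: "G (Suc j) holomorphic_on \<D>" "inj_on (G (Suc j)) \<D>" "G (Suc j) 0 = 0"
      using G(3)[of "Suc j"] j by auto
    obtain \<phi> where \<phi>: "\<phi> holomorphic_on \<D>" "\<phi> 0 = 0" "\<phi> ` \<D> \<subseteq> \<D>"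
        "\<And>z. z \<in> \<D> \<Longrightarrow> G j (\<phi> z) = G (Suc j) z" "deriv (G (Suc j)) 0 = deriv (G j) 0 * deriv \<phi> 0"
      by (rule subordination[OF Gj Gsj(1,3) G(4)[OF j]]) (rule that; assumption)
    have "of_nat (Suc j) * L / of_nat n = of_nat j * L / of_nat n + L / of_nat n"
      by (simp add: distrib_right add_divide_distrib)
    then have "exp (of_nat j * L / of_nat n) * exp (L / of_nat n) = exp (of_nat (Suc j) * L / of_nat n)"
      by (simp only: exp_add)
    also have "\<dots> = exp (of_nat j * L / of_nat n) * deriv \<phi> 0"
      using \<phi>(5) G(3)[of j] G(3)[of "Suc j"] j by simp
    finally have "deriv \<phi> 0 = exp (L / of_nat n)" by simp
    then show ?thesis unfolding P_def using \<phi>(1-4) by (intro exI[of _ \<phi>] conjI ballI) simp_all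
  qed
  then have "\<forall>j. \<exists>\<phi>. j < n \<longrightarrow> P j \<phi>" by blast
  then obtain \<phi> where \<phi>: "\<forall>j. j < n \<longrightarrow> P j (\<phi> j)" by (rule choice[THEN exE])
  show ?thesis
  proof (rule that[of G \<phi>])
    show "G 0 z = z" for z by (rule G(1))
    show "G n = f" by (rule G(2))
    fix j assume "j < n"
    then have "P j (\<phi> j)" using \<phi> by blast
    then show "\<phi> j holomorphic_on \<D> \<and> \<phi> j 0 = 0 \<and> \<phi> j ` \<D> \<subseteq> \<D> \<and> deriv (\<phi> j) 0 = exp (L / of_nat n)
       \<and> (\<forall>z\<in>\<D>. G (Suc j) z = G j (\<phi> j z))"
      unfolding P_def .
  qed
qed

section \<open>Construction of infinitesimal arrays\<close>

text \<open>Each \<open>\<phi> j\<close> is the transform of a measure by the Herglotz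
  representation. Composing new factors on the inside matches the order in which
  \<open>mono_conv_upto\<close> appends measures.\<close>

lemma ex_convolution_row:
  fixes G \<phi> :: "nat \<Rightarrow> complex \<Rightarrow> complex"
  assumes n: "n \<ge> 1" and G0: "\<And>z. G 0 z = z"
    and \<phi>: "\<And>j. j < n \<Longrightarrow> \<phi> j holomorphic_on \<D> \<and> \<phi> j 0 = 0 \<and> \<phi> j ` \<D> \<subseteq> \<D> \<and> deriv (\<phi> j) 0 = c
       \<and> (\<forall>z\<in>\<D>. G (Suc j) z = G j (\<phi> j z))"
  obtains m where "\<And>j. j \<in> {1..n} \<Longrightarrow> circle_prob (m j) \<and> mom (m j) 1 = c"
    "\<And>z. z \<in> \<D> \<Longrightarrow> eta (mono_conv_upto m n) z = G n z"
proof -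
  have "\<exists>\<rho>. j < n \<longrightarrow> circle_prob \<rho> \<and> (\<forall>z\<in>\<D>. eta \<rho> z = \<phi> j z)" for j
  proof (cases "j < n")
    case True
    have "\<phi> j z \<in> \<D>" if "z \<in> \<D>" for z using \<phi>[OF True] that by blast
    then obtain \<rho> where "circle_prob \<rho>" "\<And>z. z \<in> \<D> \<Longrightarrow> eta \<rho> z = \<phi> j z"
      using ex_circle_prob_eta[of "\<phi> j"] \<phi>[OF True] by metis
    then show ?thesis by blast
  qed simp
  then have "\<forall>j. \<exists>\<rho>. j < n \<longrightarrow> circle_prob \<rho> \<and> (\<forall>z\<in>\<D>. eta \<rho> z = \<phi> j z)" by blast
  then obtain \<rho> where \<rho>: "\<forall>j. j < n \<longrightarrow> circle_prob (\<rho> j) \<and> (\<forall>z\<in>\<D>. eta (\<rho> j) z = \<phi> j z)"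
    by (rule choice[THEN exE])
  \<comment> \<open>Factors are numbered from \<open>0\<close>, members of a row from
    \<open>1\<close>.\<close>
  define m where "m j = \<rho> (j - 1)" for j
  have cp: "circle_prob (m j)" if "j \<in> {1..n}" for j
    using \<rho>[rule_format, of "j - 1"] that by (auto simp: m_def)
  have mom: "mom (m j) 1 = c" if j: "j \<in> {1..n}" for j
  proof -
    have jn: "j - 1 < n" using j by auto
    have "deriv (eta (m j)) 0 = deriv (\<phi> (j - 1)) 0"
      by (rule complex_derivative_transform_within_open[of _ \<D>])
        (use eta_holomorphic[OF cp[OF j]] \<phi>[OF jn] \<rho> jn in \<open>auto simp: m_def\<close>)
    then show ?thesis using deriv_eta_0[OF cp[OF j]] \<phi>[OF jn] by simp
  qed
  have "\<forall>z\<in>\<D>. eta (mono_conv_upto m k) z = G k z" if "1 \<le> k" "k \<le> n" for k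
    using that
  proof (induction k rule: dec_induct)
    case base
    have "eta (m 1) z = G 1 z" if "z \<in> \<D>" for z
      using \<rho> \<phi>[of 0] n that by (simp add: m_def G0)
    then show ?case by (simp add: mono_conv_upto_1[unfolded One_nat_def])
  next
    case (step k)
    show ?case
    proof
      fix z :: complex assume z: "z \<in> \<D>"
      have cpk: "circle_prob (mono_conv_upto m k)" "circle_prob (m (Suc k))"
        using step.hyps step.prems by (auto intro!: mono_conv_upto_circle_prob cp)
      have e: "eta (m (Suc k)) z = \<phi> k z" using \<rho> step.prems z by (simp add: m_def)
      have "eta (mono_conv_upto m (Suc k)) z = eta (mono_conv_upto m k) (\<phi> k z)"
        using mono_conv_props(2)[OF cpk z] step.hyps by (simp add: mono_conv_upto_Suc e)
      also have "\<phi> k z \<in> \<D>" using \<phi>[of k] step.prems z by (auto simp: image_subset_iff)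
      then have "eta (mono_conv_upto m k) (\<phi> k z) = G k (\<phi> k z)" using step.IH step.prems by simp
      also have "\<dots> = G (Suc k) z" using \<phi>[of k] step.prems z by simp
      finally show "eta (mono_conv_upto m (Suc k)) z = G (Suc k) z" .
    qed
  qed
  then show ?thesis using that[of m] cp mom n by blast
qed

text \<open>Row \<open>n\<close> has length \<open>n\<close>. Its common first moment
  \<open>c n\<close> bounds the mass off an arc uniformly over the row, and the dilation by
  \<open>a n\<close> multiplies the \<open>p\<close>-th moment of \<open>\<nu>\<close> by
  \<open>a n ^ p\<close>, so convergence of moments yields the weak limit.\<close>

lemma limit_of_infinitesimal_arrayI:
  assumes \<mu>: "circle_prob \<mu>" and \<nu>: "circle_prob \<nu>"
    and row: "\<And>n. n \<ge> 1 \<Longrightarrow> \<exists>m. (\<forall>j\<in>{1..n}. circle_prob (m j) \<and> mom (m j) 1 = c n) \<and>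
      (\<forall>z\<in>\<D>. eta (mono_conv_upto m n) z = eta \<nu> (a n * z))"
    and c: "c \<longlonglongrightarrow> 1" and a: "\<And>n. norm (a n) \<le> 1"
    and mom: "\<And>p. p > 0 \<Longrightarrow> (\<lambda>n. a n ^ p * mom \<nu> p) \<longlonglongrightarrow> mom \<mu> p"
  shows "limit_of_infinitesimal_array \<mu>"
proof -
  \<comment> \<open>Row \<open>0\<close> is filled with \<open>\<mu>\<close> as a default:
    \<open>mono_conv_upto\<close> of length \<open>0\<close> returns the first member, so the
    convolution is a probability measure for every \<open>n\<close>.\<close>
  define P where "P n m \<longleftrightarrow> (n \<ge> 1 \<longrightarrow> (\<forall>j\<in>{1..n}. circle_prob (m j) \<and> mom (m j) 1 = c n) \<and>
      (\<forall>z\<in>\<D>. eta (mono_conv_upto m n) z = eta \<nu> (a n * z))) \<and> (n = 0 \<longrightarrow> m = (\<lambda>_. \<mu>))"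
    for n and m :: "nat \<Rightarrow> complex measure"
  have "\<exists>m. P n m" for n
  proof (cases "n = 0")
    case True
    then show ?thesis by (intro exI[of _ "\<lambda>_. \<mu>"]) (simp add: P_def)
  next
    case False
    then have "n \<ge> 1" by simp
    from row[OF this] obtain m where "(\<forall>j\<in>{1..n}. circle_prob (m j) \<and> mom (m j) 1 = c n) \<and>
      (\<forall>z\<in>\<D>. eta (mono_conv_upto m n) z = eta \<nu> (a n * z))" by (elim exE)
    then show ?thesis using False by (intro exI[of _ m]) (simp add: P_def)
  qed
  then have "\<forall>n. \<exists>m. P n m" by blast
  then obtain m where m0: "\<forall>n. P n (m n)" by (rule choice[THEN exE])
  have m: "\<And>n j. n \<ge> 1 \<Longrightarrow> j \<in> {1..n} \<Longrightarrow> circle_prob (m n j)"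
      "\<And>n j. n \<ge> 1 \<Longrightarrow> j \<in> {1..n} \<Longrightarrow> mom (m n j) 1 = c n"
      "\<And>n z. n \<ge> 1 \<Longrightarrow> z \<in> \<D> \<Longrightarrow> eta (mono_conv_upto (m n) n) z = eta \<nu> (a n * z)"
      "m 0 = (\<lambda>_. \<mu>)"
    using m0 unfolding P_def by simp_all
  let ?M = "\<lambda>n. mono_conv_upto (m n) n"
  have M: "circle_prob (?M n)" for n
  proof (cases "n = 0")
    case True
    then show ?thesis using m(4) \<mu> by (simp add: mono_conv_upto_def)
  next
    case False
    then show ?thesis using m(1) by (intro mono_conv_upto_circle_prob) auto
  qed
  have "mom (?M n) p = a n ^ p * mom \<nu> p" if n: "n \<ge> 1" and p: "p > 0" for n p
  proof (rule moments_eq_if_psi_scaled[OF M \<nu>, of 1])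
    fix z :: complex assume z: "z \<in> \<D>"
    have "norm (a n) * norm z \<le> 1 * norm z" using a by (intro mult_right_mono) auto
    then have "a n * z \<in> \<D>" using z by (simp add: norm_mult)
    then show "psi (?M n) z = psi \<nu> (a n * z)"
      using psi_eq_eta[OF M z] psi_eq_eta[OF \<nu>] m(3)[OF n z] by simp
  qed (use a p in auto)
  then have "(\<lambda>n. mom (?M n) p) \<longlonglongrightarrow> mom \<mu> p" if "p > 0" for p
    by (intro Lim_transform_eventually[OF mom[OF that]])
      (use that in \<open>auto simp: eventually_sequentially intro!: exI[of _ 1]\<close>)
  then have wc: "weak_conv_circle ?M \<mu>" by (rule weak_conv_circle_if_moments[OF M \<mu>])
  have "(\<lambda>n. SUP j\<in>{1..n}. measure (m n j) (\<T> - cis ` {-\<delta>..\<delta>})) \<longlonglongrightarrow> 0" if \<delta>: "\<delta> \<in> {0<..<pi}" for \<delta>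
  proof (rule tendsto_sandwich[of "\<lambda>_. 0"])
    let ?S = "\<lambda>n. SUP j\<in>{1..n}. measure (m n j) (\<T> - cis ` {-\<delta>..\<delta>})"
    have "0 \<le> ?S n" if "n \<ge> 1" for n
      using that by (intro cSUP_upper2[where x = 1]) (auto intro!: bdd_above_finite)
    then show "\<forall>\<^sub>F n in sequentially. 0 \<le> ?S n" by (auto simp: eventually_sequentially)
    have "?S n \<le> (1 - Re (c n)) / (1 - cos \<delta>)" if n: "n \<ge> 1" for n
    proof (rule cSUP_least)
      fix j assume j: "j \<in> {1..n}"
      show "measure (m n j) (\<T> - cis ` {-\<delta>..\<delta>}) \<le> (1 - Re (c n)) / (1 - cos \<delta>)"
        using arc_complement_measure_le[OF m(1)[OF n j], of \<delta>] \<delta> m(2)[OF n j] by simp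
    qed (use n in auto)
    then show "\<forall>\<^sub>F n in sequentially. ?S n \<le> (1 - Re (c n)) / (1 - cos \<delta>)"
      by (auto simp: eventually_sequentially)
    have "cos \<delta> < 1" using cos_monotone_0_pi[of 0 \<delta>] \<delta> by simp
    moreover have "(\<lambda>n. (1 - Re (c n)) / (1 - cos \<delta>)) \<longlonglongrightarrow> (1 - Re 1) / (1 - cos \<delta>)"
      using calculation by (intro tendsto_intros c) auto
    ultimately show "(\<lambda>n. (1 - Re (c n)) / (1 - cos \<delta>)) \<longlonglongrightarrow> 0" by simp
  qed simp
  then have "infinitesimal_array (\<lambda>n. n) m"
    unfolding infinitesimal_array_def using m(1) by (auto simp: mono_on_def filterlim_ident)
  with wc show ?thesis unfolding limit_of_infinitesimal_array_def by blast
qed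

text \<open>Dilating \<open>eta \<mu>\<close> by \<open>r n < 1\<close> makes it univalent beyond
  the closed disc, as the factorization requires. The dilated measures converge to
  \<open>\<mu>\<close> because \<open>r n\<close> tends to \<open>1\<close>.\<close>

lemma univalent_imp_limit:
  assumes \<mu>: "circle_prob \<mu>" and u: "univalent_on (psi \<mu>) \<D>"
  shows "limit_of_infinitesimal_array \<mu>"
proof -
  have inj: "inj_on (eta \<mu>) \<D>" using u inj_on_eta_iff[OF \<mu>] by (simp add: univalent_on_def)
  define d where "d = deriv (eta \<mu>) 0"
  have d0: "d \<noteq> 0"
    using holomorphic_injective_imp_regular[OF eta_holomorphic[OF \<mu>] open_ball inj] by (simp add: d_def)
  have d1: "norm d \<le> 1"
    unfolding d_def using norm_eta_less_1[OF \<mu>]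
    by (intro norm_deriv_0_le_1 eta_holomorphic[OF \<mu>]) auto
  define r :: "nat \<Rightarrow> real" where "r n = real n / (real n + 1)" for n
  \<comment> \<open>A logarithm of the derivative \<open>r n * d\<close> of the dilated map. For
    \<open>n \<ge> 1\<close> its real part is negative since \<open>r n < 1\<close>; moreover
    \<open>L n / n\<close> tends to \<open>0\<close>, so the common first moment \<open>c n\<close>
    tends to \<open>1\<close>.\<close>
  define L where "L n = of_real (ln (r n)) + Ln d" for n
  define c where "c n = exp (L n / of_nat n)" for n
  show ?thesis
  proof (rule limit_of_infinitesimal_arrayI[OF \<mu> \<mu>])
    fix n :: nat assume n: "n \<ge> 1"
    have r: "0 < r n" "r n < 1" using n by (auto simp: r_def field_simps)
    define f where "f z = eta \<mu> (of_real (r n) * z)" for z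
    define \<rho> where "\<rho> = 1 / r n"
    have \<rho>: "1 < \<rho>" using r by (simp add: \<rho>_def)
    have rho_D: "of_real (r n) * z \<in> \<D>" if "z \<in> ball 0 \<rho>" for z
      using that r by (simp add: \<rho>_def norm_mult field_simps)
    have im: "(\<lambda>z. of_real (r n) * z) ` ball 0 \<rho> \<subseteq> \<D>" using rho_D by (rule image_subsetI)
    have lin: "(\<lambda>z. of_real (r n) * z) holomorphic_on S" for S by (intro holomorphic_intros)
    have f1: "f holomorphic_on ball 0 \<rho>"
      using holomorphic_on_compose_gen[OF lin eta_holomorphic[OF \<mu>] im] unfolding f_def[abs_def] o_def .
    have f2: "inj_on f (ball 0 \<rho>)"
    proof (rule inj_onI)
      fix x y assume xy: "x \<in> ball 0 \<rho>" "y \<in> ball 0 \<rho>" "f x = f y"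
      have "of_real (r n) * x = of_real (r n) * y"
        by (rule inj_onD[OF inj xy(3)[unfolded f_def] rho_D[OF xy(1)] rho_D[OF xy(2)]])
      then show "x = y" using r by simp
    qed
    have f5: "f ` cball 0 1 \<subseteq> \<D>"
    proof (rule image_subsetI)
      fix z :: complex assume "z \<in> cball 0 1"
      then have "z \<in> ball 0 \<rho>" using \<rho> by simp
      then show "f z \<in> \<D>" using norm_eta_less_1[OF \<mu> rho_D] by (simp add: f_def)
    qed
    have D\<rho>: "\<D> \<subseteq> ball 0 \<rho>" using \<rho> by auto
    have "deriv f 0 = deriv (eta \<mu>) 0 * deriv (\<lambda>z. of_real (r n) * z) 0"
      by (rule deriv_compose_disc[OF eta_holomorphic[OF \<mu>] lin]) (auto simp: f_def)
    then have "deriv f 0 = d * of_real (r n)" by (simp add: d_def)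
    also have "\<dots> = exp (L n)"
      using d0 r by (simp add: L_def exp_add exp_Ln exp_of_real)
    finally have L1: "deriv f 0 = exp (L n)" .
    have "ln (r n) < 0" "ln (norm d) \<le> 0" using r d0 d1 by auto
    moreover have "Re (L n) = ln (r n) + ln (norm d)" using d0 by (simp add: L_def)
    ultimately have L2: "Re (L n) < 0" by linarith
    obtain G \<phi> :: "nat \<Rightarrow> complex \<Rightarrow> complex" where G: "\<And>z. G 0 z = z" "G n = f"
      "\<And>j. j < n \<Longrightarrow> \<phi> j holomorphic_on \<D> \<and> \<phi> j 0 = 0 \<and> \<phi> j ` \<D> \<subseteq> \<D> \<and> deriv (\<phi> j) 0 = exp (L n / of_nat n)
       \<and> (\<forall>z\<in>\<D>. G (Suc j) z = G j (\<phi> j z))"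
      by (rule univalent_factorization[OF f1 f2 \<rho> _ f5 L1 L2, of n]) (use n in \<open>auto simp: f_def\<close>)
    obtain m where "\<And>j. j \<in> {1..n} \<Longrightarrow> circle_prob (m j) \<and> mom (m j) 1 = exp (L n / of_nat n)"
      "\<And>z. z \<in> \<D> \<Longrightarrow> eta (mono_conv_upto m n) z = G n z"
      using ex_convolution_row[OF n G(1) G(3)] by blast
    then show "\<exists>m. (\<forall>j\<in>{1..n}. circle_prob (m j) \<and> mom (m j) 1 = c n) \<and>
      (\<forall>z\<in>\<D>. eta (mono_conv_upto m n) z = eta \<mu> (of_real (r n) * z))"
      by (intro exI[of _ m]) (simp add: c_def G(2) f_def)
  next
    have "(\<lambda>n. ln (r n) / real n) \<longlonglongrightarrow> 0" unfolding r_def by real_asymp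
    then have 1: "(\<lambda>n. complex_of_real (ln (r n) / real n)) \<longlonglongrightarrow> of_real 0" by (rule tendsto_of_real)
    have 2: "(\<lambda>n. Ln d / of_nat n) \<longlonglongrightarrow> 0" by (rule lim_const_over_n)
    have "(\<lambda>n. L n / of_nat n) \<longlonglongrightarrow> 0"
      using tendsto_add[OF 1 2] by (simp add: L_def add_divide_distrib)
    then have "c \<longlonglongrightarrow> exp 0" unfolding c_def by (rule tendsto_exp)
    then show "c \<longlonglongrightarrow> 1" by simp
  next
    show "norm (complex_of_real (r n)) \<le> 1" for n unfolding norm_of_real by (simp add: r_def)
  next
    fix p :: nat
    have "r \<longlonglongrightarrow> 1" unfolding r_def by real_asymp
    then have "(\<lambda>n. complex_of_real (r n)) \<longlonglongrightarrow> of_real 1" by (rule tendsto_of_real)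
    then have "(\<lambda>n. complex_of_real (r n) ^ p * mom \<mu> p) \<longlonglongrightarrow> of_real 1 ^ p * mom \<mu> p"
      by (intro tendsto_mult tendsto_power tendsto_const)
    then show "(\<lambda>n. complex_of_real (r n) ^ p * mom \<mu> p) \<longlonglongrightarrow> mom \<mu> p" by simp
  qed
qed

text \<open>Each row repeats one contraction \<open>c n * z\<close>. The individual factors approach
  the identity while their composition approaches the constant \<open>0\<close>, the transform of
  Haar measure.\<close>

lemma haar_imp_limit: "limit_of_infinitesimal_array haar_circle"
proof -
  obtain \<nu> where \<nu>: "circle_prob \<nu>" "\<And>z. z \<in> \<D> \<Longrightarrow> eta \<nu> z = z"
    using ex_circle_prob_eta[of "\<lambda>z. z"] by (auto intro: holomorphic_on_ident)
  \<comment> \<open>The rate \<open>1 / sqrt n\<close> is slow enough: \<open>c n\<close> tends to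
    \<open>1\<close>, but \<open>c n ^ n = exp (- sqrt n)\<close> tends to \<open>0\<close>.\<close>
  define c where "c n = exp (- (1 / sqrt (real n)))" for n
  have c: "0 < c n" "c n \<le> 1" for n by (auto simp: c_def)
  show ?thesis
  proof (rule limit_of_infinitesimal_arrayI[OF circle_prob_haar \<nu>(1)])
    fix n :: nat assume n: "n \<ge> 1"
    let ?C = "complex_of_real (c n)"
    have cD: "of_real x * z \<in> \<D>" if "0 \<le> x" "x \<le> 1" "z \<in> \<D>" for x and z :: complex
      using that mult_right_mono[of x 1 "norm z"] by (simp add: norm_mult)
    have "?C ^ n * z \<in> \<D>" if "z \<in> \<D>" for z
      using cD[of "c n ^ n" z] c[of n] that by (simp add: power_le_one)
    moreover obtain m where "\<And>j. j \<in> {1..n} \<Longrightarrow> circle_prob (m j) \<and> mom (m j) 1 = ?C"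
      "\<And>z. z \<in> \<D> \<Longrightarrow> eta (mono_conv_upto m n) z = ?C ^ n * z"
    proof (rule ex_convolution_row[OF n, of "\<lambda>j z. ?C ^ j * z" "\<lambda>_ z. ?C * z" ?C])
      show "(\<lambda>z. ?C * z) holomorphic_on \<D> \<and> ?C * 0 = 0 \<and> (\<lambda>z. ?C * z) ` \<D> \<subseteq> \<D> \<and>
          deriv (\<lambda>z. ?C * z) 0 = ?C \<and> (\<forall>z\<in>\<D>. ?C ^ Suc j * z = ?C ^ j * (?C * z))" for j
        using cD[of "c n"] c[of n] by (auto intro!: holomorphic_intros simp: image_subset_iff)
    qed (use that in auto)
    ultimately show "\<exists>m. (\<forall>j\<in>{1..n}. circle_prob (m j) \<and> mom (m j) 1 = complex_of_real (c n)) \<and>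
      (\<forall>z\<in>\<D>. eta (mono_conv_upto m n) z = eta \<nu> (complex_of_real (c n) ^ n * z))"
      by (intro exI[of _ m]) (simp add: \<nu>(2))
  next
    have "c \<longlonglongrightarrow> 1" unfolding c_def by real_asymp
    then have "(\<lambda>n. complex_of_real (c n)) \<longlonglongrightarrow> of_real 1" by (rule tendsto_of_real)
    then show "(\<lambda>n. complex_of_real (c n)) \<longlonglongrightarrow> 1" by simp
  next
    show "norm (complex_of_real (c n) ^ n) \<le> 1" for n
      using c[of n] by (simp add: norm_power power_le_one)
  next
    fix p :: nat assume p: "p > 0"
    have e: "c n ^ n = exp (- sqrt (real n))" for n
      by (simp add: c_def exp_of_nat_mult[symmetric] real_div_sqrt)
    have "(\<lambda>n. exp (- sqrt (real n))) \<longlonglongrightarrow> 0" by real_asymp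
    then have "(\<lambda>n. complex_of_real (c n ^ n)) \<longlonglongrightarrow> of_real 0" unfolding e by (rule tendsto_of_real)
    then have "(\<lambda>n. (complex_of_real (c n ^ n)) ^ p * mom \<nu> p) \<longlonglongrightarrow> of_real 0 ^ p * mom \<nu> p"
      by (intro tendsto_mult tendsto_power tendsto_const)
    then show "(\<lambda>n. (complex_of_real (c n) ^ n) ^ p * mom \<nu> p) \<longlonglongrightarrow> mom haar_circle p"
      using p by (simp add: mom_haar zero_power)
  qed
qed

theorem theorem7p5:
  fixes \<mu> :: "complex measure"
  assumes "circle_prob \<mu>"
  shows "limit_of_infinitesimal_array \<mu> \<longleftrightarrow>
    univalent_on (psi \<mu>) \<D> \<or> \<mu> = haar_circle"
  using limit_imp_univalent_or_haar[OF assms] univalent_imp_limit[OF assms] haar_imp_limit by blast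

end
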